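(* For every integer $n$ with $4\le n\le 12$, $\rho(Q_n)=5$. For every integer $n\geq 13$, there is a unique integer $m\ge 6$ for which $2^{m-2}-\nu_{m-1}+1\le n\le 2^{m-1}-\nu_m$, and for this $m$ one has $\rho(Q_n)=m$.
   Context: $Q_n$ is the $n$-dimensional hypercube graph: its vertices are the binary strings of length $n$ and two vertices are adjacent iff they differ in exactly one coordinate. A labeling of the vertices of a graph $G$ with two labels is 2-distinguishing if no nontrivial automorphism of $G$ preserves the labels; $G$ is 2-distinguishable if it has such a labeling ($Q_n$ is 2-distinguishable for $n\ge 4$). For a 2-distinguishable graph $G$, $\rho(G)$, the cost of 2-distinguishing, is the minimum size of a label class over all 2-distinguishing labelings of $G$. All matrices are binary, with entries regarded as elements of $\mathbb{Z}_2$. For an $m\times n$ matrix $X$, a row permutation is a $\sigma\in S_m$, and $X_\sigma$ is the result of applying $\sigma$ to the rows of $X$ (row $i$ is moved to position $\sigma(i)$). A column permaut is a pair $\varphi=(\pi,\{\psi_i\}_{i=1}^n)$ with $\pi\in S_n$ and each $\psi_i:\mathbb{Z}_2\to\mathbb{Z}_2$ a bijection (the identity or the swap $0\leftrightarrow 1$); $X^\varphi$ is the $m\times n$ matrix whose column $j$ is obtained from column $\pi^{-1}(j)$ of $X$ by applying $\psi_{\pi^{-1}(j)}$ to each entry. A symmetry of $X$ is a pair $(\sigma,\varphi)$ with $X_\sigma=X^\varphi$. $X$ is asymmetric if its only symmetry is the trivial one $(id,id)$. For $m\ge 5$, $\nu_m$ denotes the smallest number of columns for which there is an asymmetric binary $m\times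 \nu_m$ matrix. *)

theory Defs
  imports "HOL-Combinatorics.Permutations" "HOL-Library.Z2" "Jordan_Normal_Form.Matrix"
begin

record 'v graph =
  verts :: "'v set"
  adj :: "'v \<Rightarrow> 'v \<Rightarrow> bool"

text \<open>Only the values of an automorphism on the vertex set matter; accordingly,
  an automorphism is trivial if it fixes every vertex.\<close>

definition automorphism :: "'v graph \<Rightarrow> ('v \<Rightarrow> 'v) \<Rightarrow> bool" where
  "automorphism G f \<longleftrightarrow> bij_betw f (verts G) (verts G) \<and>
     (\<forall>u\<in>verts G. \<forall>v\<in>verts G. adj G u v \<longleftrightarrow> adj G (f u) (f v))"

definition distinguishing2 :: "'v graph \<Rightarrow> ('v \<Rightarrow> bool) \<Rightarrow> bool" where
  "distinguishing2 G c \<longleftrightarrow>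
     (\<forall>f. automorphism G f \<and> (\<forall>v\<in>verts G. c (f v) = c v) \<longrightarrow> (\<forall>v\<in>verts G. f v = v))"

definition label_class :: "'v graph \<Rightarrow> ('v \<Rightarrow> bool) \<Rightarrow> bool \<Rightarrow> 'v set" where
  "label_class G c b = {v \<in> verts G. c v = b}"

text \<open>Meaningful for finite 2-distinguishable graphs; otherwise an unspecified number.\<close>

definition cost2 :: "'v graph \<Rightarrow> nat" where
  "cost2 G = (LEAST k. \<exists>c b. distinguishing2 G c \<and> k = card (label_class G c b))"

definition hypercube :: "nat \<Rightarrow> bit list graph" where
  "hypercube n =
     \<lparr> verts = {v. length v = n},
       adj = (\<lambda>u v. \<exists>!i. i < n \<and> u ! i \<noteq> v ! i) \<rparr>"

text \<open>Rows and columns are indexed from 0. Row \<open>i\<close> of \<open>X\<close> becomes row \<open>\<sigma> i\<close> of the result.\<close>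

definition permute_rows :: "(nat \<Rightarrow> nat) \<Rightarrow> bit mat \<Rightarrow> bit mat" where
  "permute_rows \<sigma> X =
     mat (dim_row X) (dim_col X) (\<lambda>(i, j). X $$ (inv_into UNIV \<sigma> i, j))"

text \<open>In a column permaut \<open>(\<pi>, \<psi>)\<close> of matrices with \<open>n\<close> columns, the values of \<open>\<psi>\<close>
  at indices \<open>\<ge> n\<close> carry no information.\<close>

type_synonym permaut = "(nat \<Rightarrow> nat) \<times> (nat \<Rightarrow> bit \<Rightarrow> bit)"

definition column_permaut :: "nat \<Rightarrow> permaut \<Rightarrow> bool" where
  "column_permaut n = (\<lambda>(\<pi>, \<psi>). \<pi> permutes {..<n} \<and> (\<forall>i<n. bij (\<psi> i)))"

definition trivial_permaut :: "nat \<Rightarrow> permaut \<Rightarrow> bool" where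
  "trivial_permaut n = (\<lambda>(\<pi>, \<psi>). \<pi> = id \<and> (\<forall>i<n. \<psi> i = id))"

definition apply_permaut :: "permaut \<Rightarrow> bit mat \<Rightarrow> bit mat" where
  "apply_permaut = (\<lambda>(\<pi>, \<psi>) X.
     mat (dim_row X) (dim_col X)
       (\<lambda>(i, j). \<psi> (inv_into UNIV \<pi> j) (X $$ (i, inv_into UNIV \<pi> j))))"

definition matrix_symmetry :: "bit mat \<Rightarrow> (nat \<Rightarrow> nat) \<Rightarrow> permaut \<Rightarrow> bool" where
  "matrix_symmetry X \<sigma> \<phi> \<longleftrightarrow>
     \<sigma> permutes {..<dim_row X} \<and> column_permaut (dim_col X) \<phi> \<and>
     permute_rows \<sigma> X = apply_permaut \<phi> X"

definition asymmetric :: "bit mat \<Rightarrow> bool" where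
  "asymmetric X \<longleftrightarrow>
     (\<forall>\<sigma> \<phi>. matrix_symmetry X \<sigma> \<phi> \<longrightarrow> \<sigma> = id \<and> trivial_permaut (dim_col X) \<phi>)"

definition nu :: "nat \<Rightarrow> nat" where
  "nu m = (LEAST k. \<exists>X \<in> carrier_mat m k. asymmetric X)"

end

theory Submission
  imports Defs
begin

text \<open>An automorphism of \<open>Q\<^sub>n\<close> is an isometry of the Hamming distance, and so it permutes the
coordinates and then flips some of them: it is a column permaut applied to the vertices. Write the
\<open>m\<close> vertices of a label class as the rows of an \<open>m \<times> n\<close> matrix. An automorphism that preserves
the labels permutes these rows, so the labeling is 2-distinguishing exactly when the matrix is
asymmetric (\<open>distinguishing2_class_iff_asymmetric\<close>). Hence \<open>\<rho>(Q\<^sub>n)\<close> is the least \<open>m\<close> for which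
there is an asymmetric \<open>m \<times> n\<close> matrix.

Now fix \<open>m\<close> and let \<open>n\<close> vary. Column permauts are at our disposal, so a column matters only as a
set of rows up to complement, and a matrix only as a collection of such classes. It is asymmetric
exactly when its \<open>n\<close> columns lie in \<open>n\<close> different classes and no nontrivial permutation of the rows
preserves the collection (\<open>asymmetric_size_Suc_iff\<close>). There are \<open>2\<^bsup>m-1\<^esup>\<close> classes, and a collection
has the same stabilizer as its complement; thus the possible numbers of columns are symmetric about
\<open>2\<^bsup>m-2\<^esup>\<close> and lie between \<open>\<nu>\<^sub>m\<close> and \<open>2\<^bsup>m-1\<^esup> - \<nu>\<^sub>m\<close>.

For \<open>m \<ge> 5\<close> every number in this interval occurs (\<open>asymmetric_size_iff\<close>). By the symmetry only the
lower half has to be covered, by three kinds of constructions. From \<open>\<nu>\<^sub>m\<close> up to \<open>m div 2 + 1\<close>, add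
classes one at a time: permutations preserve the weight \<open>min |D| (m - |D|)\<close> of a class, so a class
of a weight that does not occur yet destroys no rigidity, and there are \<open>m div 2 + 1\<close> weights. From
\<open>m - 1\<close> up to \<open>2\<^bsup>m-2\<^esup>\<close>, take the edges of a path through all rows but one and the singleton of one
end of the path, and add arbitrary classes other than pairs and the singleton of the other end.
In between, enlarge the edges of a shorter path by private pendant rows, which handles nearly twice
as many rows with the same number of columns. The path also gives \<open>\<nu>\<^sub>m \<le> m - 1\<close>.

For at most four rows, involutions of the rows show that \<open>n \<ge> 4\<close> columns never suffice. Also
\<open>\<nu>\<^sub>5 = 4\<close>: an asymmetric \<open>5 \<times> 3\<close> matrix would have five of the eight vertices of \<open>Q\<^sub>3\<close> as
rows, and the other three would form an asymmetric \<open>3 \<times> 3\<close> matrix, which does not exist.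
So five labeled vertices are optimal for \<open>4 \<le> n \<le> 12\<close>. Finally, the bounds
\<open>2\<^bsup>m-1\<^esup> - \<nu>\<^sub>m\<close> do not decrease and are unbounded, so each \<open>n \<ge> 13\<close> lies in a gap between two
consecutive ones; above the lower one no smaller \<open>m\<close> works, and \<open>n\<close> is then automatically at
least \<open>\<nu>\<^sub>m\<close>, because \<open>\<nu>\<^sub>m \<le> m - 1\<close> while the lower one grows exponentially in \<open>m\<close>.\<close>

section \<open>Automorphisms of the hypercube\<close>

definition hamming :: "'a list \<Rightarrow> 'a list \<Rightarrow> nat" where
  "hamming u v = card {i. i < length u \<and> u ! i \<noteq> v ! i}"

lemma hamming_eq_0_iff: "length u = length v \<Longrightarrow> hamming u v = 0 \<longleftrightarrow> u = v"
  unfolding hamming_def by (auto simp: list_eq_iff_nth_eq)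

lemma hamming_triangle:
  assumes "length u = length v"
  shows "hamming u w \<le> hamming u v + hamming v w"
proof -
  have "hamming u w \<le> card ({i. i < length u \<and> u ! i \<noteq> v ! i} \<union> {i. i < length v \<and> v ! i \<noteq> w ! i})"
    unfolding hamming_def using assms by (intro card_mono) auto
  also have "\<dots> \<le> hamming u v + hamming v w"
    unfolding hamming_def by (rule card_Un_le)
  finally show ?thesis .
qed

lemma hamming_step:
  assumes "length u = length v" and "hamming u v = Suc k"
  obtains w where "length w = length u" "hamming u w = 1" "hamming w v = k"
proof -
  let ?D = "{i. i < length u \<and> u ! i \<noteq> v ! i}"
  have D: "card ?D = Suc k" using assms(2) by (simp add: hamming_def)
  then have "?D \<noteq> {}" by (metis card.empty nat.distinct(1))
  then obtain i where i: "i \<in> ?D" by blast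
  let ?w = "u[i := v ! i]"
  have "{j. j < length u \<and> u ! j \<noteq> ?w ! j} = {i}"
    using i by (auto simp: nth_list_update)
  moreover have "{j. j < length ?w \<and> ?w ! j \<noteq> v ! j} = ?D - {i}"
    using i by (auto simp: nth_list_update)
  ultimately show thesis
    using that[of ?w] D i by (simp add: hamming_def)
qed

lemma verts_hypercube [simp]: "verts (hypercube n) = {v. length v = n}"
  by (simp add: hypercube_def)

lemma hamming_eq_1_iff: "hamming u v = 1 \<longleftrightarrow> (\<exists>!i. i < length u \<and> u ! i \<noteq> v ! i)"
proof -
  let ?D = "{i. i < length u \<and> u ! i \<noteq> v ! i}"
  have "hamming u v = 1 \<longleftrightarrow> (\<exists>i. ?D = {i})"
    by (simp add: hamming_def card_1_singleton_iff)
  also have "\<dots> \<longleftrightarrow> (\<exists>i. i \<in> ?D \<and> (\<forall>j. j \<in> ?D \<longrightarrow> j = i))"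
    by (intro arg_cong[where f = Ex] ext iffI) (simp, blast)
  also have "\<dots> \<longleftrightarrow> (\<exists>!i. i \<in> ?D)" by (simp only: Ex1_def)
  finally show ?thesis by simp
qed

lemma adj_hypercube_iff: "length u = n \<Longrightarrow> adj (hypercube n) u v \<longleftrightarrow> hamming u v = 1"
  by (simp only: hamming_eq_1_iff) (simp add: hypercube_def)

lemma automorphism_inverse:
  assumes "automorphism G f"
  shows "automorphism G (inv_into (verts G) f)"
  unfolding automorphism_def
proof (intro conjI ballI)
  have f: "bij_betw f (verts G) (verts G)" using assms by (simp add: automorphism_def)
  show inv: "bij_betw (inv_into (verts G) f) (verts G) (verts G)"
    using f by (rule bij_betw_inv_into)
  fix u v assume "u \<in> verts G" "v \<in> verts G"
  then show "adj G u v = adj G (inv_into (verts G) f u) (inv_into (verts G) f v)"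
    using assms bij_betw_inv_into_right[OF f] bij_betw_apply[OF inv]
    unfolding automorphism_def by metis
qed

lemma automorphism_hamming_le:
  assumes f: "automorphism (hypercube n) f" and "length u = n" "length v = n"
  shows "hamming (f u) (f v) \<le> hamming u v"
  using assms(2,3)
proof (induction "hamming u v" arbitrary: u)
  case 0
  then have "u = v" by (metis hamming_eq_0_iff)
  then show ?case by (simp add: hamming_def)
next
  case (Suc k)
  have len: "length (f w) = n" if "length w = n" for w
    using f that by (auto simp: automorphism_def dest: bij_betw_apply)
  obtain w where w: "length w = n" "hamming u w = 1" "hamming w v = k"
    using hamming_step[of u v k] Suc by metis
  have "hamming (f u) (f w) = 1"
    using f w Suc.prems len by (simp add: automorphism_def adj_hypercube_iff)
  moreover have "hamming (f w) (f v) \<le> k" using Suc.hyps(1)[of w] w Suc.prems by simp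
  ultimately have "hamming (f u) (f v) \<le> Suc k"
    using hamming_triangle[of "f u" "f w" "f v"] len w Suc.prems by simp
  then show ?case using Suc.hyps by simp
qed

text \<open>An automorphism of a graph is an isometry of its path metric, which for the hypercube is the
  Hamming distance.\<close>

lemma automorphism_hamming:
  assumes f: "automorphism (hypercube n) f" and "length u = n" "length v = n"
  shows "hamming (f u) (f v) = hamming u v"
proof -
  let ?g = "inv_into (verts (hypercube n)) f"
  have len: "length (f w) = n" if "length w = n" for w
    using f that by (auto simp: automorphism_def dest: bij_betw_apply)
  have "?g (f w) = w" if "length w = n" for w
    using f that by (intro bij_betw_inv_into_left[of f _ "verts (hypercube n)"])
      (auto simp: automorphism_def)
  then have "hamming u v \<le> hamming (f u) (f v)"
    using automorphism_hamming_le[OF automorphism_inverse[OF f], of "f u" "f v"] assms len by simp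
  then show ?thesis using automorphism_hamming_le[OF assms] by simp
qed

text \<open>Flipping coordinate \<open>p\<close> of \<open>z\<close> brings it closer to \<open>v\<close> exactly when \<open>v\<close> and \<open>z\<close> disagree
  there. Distances to \<open>z\<close> and to its neighbours therefore determine a vertex.\<close>

lemma hamming_flip_less_iff:
  fixes v :: "bit list"
  assumes "length v = n" "length z = n" "length w = n" "p < n" "w ! p \<noteq> z ! p"
    and "\<And>i. i < n \<Longrightarrow> i \<noteq> p \<Longrightarrow> w ! i = z ! i"
  shows "hamming v w < hamming v z \<longleftrightarrow> v ! p \<noteq> z ! p"
proof -
  let ?W = "{i. i < length v \<and> v ! i \<noteq> w ! i}" and ?Z = "{i. i < length v \<and> v ! i \<noteq> z ! i}"
  have fin: "finite ?W" "finite ?Z" by auto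
  show ?thesis
  proof (cases "v ! p = z ! p")
    case True
    then have "i \<noteq> p" if "v ! i \<noteq> z ! i" for i using that by metis
    then have "w ! i = z ! i" if "i < n" "v ! i \<noteq> z ! i" for i using that assms(6) by metis
    then have "?Z \<subseteq> ?W" using assms(1) by (metis (mono_tags, lifting) mem_Collect_eq subsetI)
    then have "card ?Z \<le> card ?W" using fin by (intro card_mono)
    then show ?thesis using True by (simp add: hamming_def)
  next
    case False
    then have "v ! p = w ! p" using assms(5) by (metis bit_not_zero_iff)
    then have "i \<noteq> p" if "v ! i \<noteq> w ! i" for i using that by metis
    then have "w ! i = z ! i" if "i < n" "v ! i \<noteq> w ! i" for i using that assms(6) by metis
    then have "?W \<subseteq> ?Z" using assms(1) by (metis (mono_tags, lifting) mem_Collect_eq subsetI)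
    moreover have "p \<in> ?Z" "p \<notin> ?W" using assms(1,4) False \<open>v ! p = w ! p\<close> by auto
    ultimately have "?W \<subset> ?Z" by blast
    then have "card ?W < card ?Z" using fin by (intro psubset_card_mono)
    then show ?thesis using False by (simp add: hamming_def)
  qed
qed

definition permaut_vertex :: "nat \<Rightarrow> permaut \<Rightarrow> bit list \<Rightarrow> bit list" where
  "permaut_vertex n = (\<lambda>(\<pi>, \<psi>) v. map (\<lambda>j. \<psi> (inv_into UNIV \<pi> j) (v ! inv_into UNIV \<pi> j)) [0..<n])"

text \<open>Permuting the two bits is adding a constant, which turns the flips of a permaut into
  arithmetic.\<close>

lemma bij_bitE:
  fixes g :: "bit \<Rightarrow> bit"
  assumes "bij g"
  obtains c where "g = (\<lambda>b. b + c)"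
proof -
  have "g 0 \<noteq> g 1" using assms by (metis bij_pointE zero_neq_one)
  then have "g b = b + g 0" for b by (cases b; cases "g 0"; cases "g 1") auto
  then show thesis using that by blast
qed

lemma bij_add_bit: "bij (\<lambda>b :: bit. b + c)"
  by (rule o_bij[where g = "\<lambda>b. b + c"]) (auto simp: fun_eq_iff add.assoc)

lemma UNIV_bit: "(UNIV :: bit set) = {0, 1}"
  by (auto simp: bit_not_zero_iff)

lemma finite_bit_lists: "finite {v :: bit list. length v = n}"
  and card_bit_lists: "card {v :: bit list. length v = n} = 2 ^ n"
proof -
  have fin: "finite (UNIV :: bit set)" by (simp add: UNIV_bit)
  have "card (UNIV :: bit set) = 2" by (simp add: UNIV_bit)
  then show "card {v :: bit list. length v = n} = 2 ^ n"
    using card_lists_length_eq[OF fin, of n] by simp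
  show "finite {v :: bit list. length v = n}" using finite_lists_length_eq[OF fin, of n] by simp
qed

lemma permaut_vertex_automorphism:
  assumes "column_permaut n \<phi>"
  shows "automorphism (hypercube n) (permaut_vertex n \<phi>)"
proof -
  obtain \<pi> \<psi> where \<phi>: "\<phi> = (\<pi>, \<psi>)" by force
  have \<pi>: "\<pi> permutes {..<n}" and \<psi>: "\<And>i. i < n \<Longrightarrow> bij (\<psi> i)"
    using assms by (auto simp: \<phi> column_permaut_def)
  have inv: "inv_into UNIV \<pi> permutes {..<n}" using \<pi> by (rule permutes_inv)
  have lt: "inv_into UNIV \<pi> j < n \<longleftrightarrow> j < n" for j using permutes_in_image[OF inv, of j] by simp
  let ?f = "permaut_vertex n \<phi>"
  have nth: "?f v ! j = \<psi> (inv_into UNIV \<pi> j) (v ! inv_into UNIV \<pi> j)" if "j < n" for v j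
    using that by (simp add: permaut_vertex_def \<phi>)
  have len: "length (?f v) = n" for v by (simp add: permaut_vertex_def \<phi>)
  have differ: "?f u ! j \<noteq> ?f v ! j \<longleftrightarrow> u ! inv_into UNIV \<pi> j \<noteq> v ! inv_into UNIV \<pi> j" if "j < n" for u v j
    using that \<psi>[of "inv_into UNIV \<pi> j"] by (auto simp: nth lt bij_def inj_eq)
  have pi_lt: "\<pi> i < n \<longleftrightarrow> i < n" for i using permutes_in_image[OF \<pi>, of i] by simp
  have differ': "?f u ! \<pi> i \<noteq> ?f v ! \<pi> i \<longleftrightarrow> u ! i \<noteq> v ! i" if "i < n" for u v i
    using differ[of "\<pi> i"] that pi_lt by (simp add: permutes_inverses[OF \<pi>])
  have "inj_on ?f {v. length v = n}"
  proof (rule inj_onI)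
    fix u v assume "u \<in> {v. length v = n}" "v \<in> {v. length v = n}" and eq: "?f u = ?f v"
    then show "u = v" using differ'[of _ u v] unfolding eq by (intro nth_equalityI) auto
  qed
  moreover have "?f ` {v. length v = n} \<subseteq> {v. length v = n}" using len by auto
  moreover note finite_bit_lists[of n]
  ultimately have "bij_betw ?f {v. length v = n} {v. length v = n}"
    by (simp add: bij_betw_def endo_inj_surj)
  moreover have "hamming (?f u) (?f v) = hamming u v" if "length u = n" "length v = n" for u v
  proof -
    have "{j. j < n \<and> ?f u ! j \<noteq> ?f v ! j} = \<pi> ` {i. i < n \<and> u ! i \<noteq> v ! i}"
    proof (intro Set.set_eqI iffI)
      fix j assume j: "j \<in> {j. j < n \<and> ?f u ! j \<noteq> ?f v ! j}"
      then have "inv_into UNIV \<pi> j \<in> {i. i < n \<and> u ! i \<noteq> v ! i}" using differ lt by auto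
      moreover have "j = \<pi> (inv_into UNIV \<pi> j)" by (simp add: permutes_inverses[OF \<pi>])
      ultimately show "j \<in> \<pi> ` {i. i < n \<and> u ! i \<noteq> v ! i}" by blast
    qed (use differ' pi_lt in auto)
    then show ?thesis
      using that len by (simp add: hamming_def card_image[OF permutes_inj_on[OF \<pi>]])
  qed
  ultimately show ?thesis
    using len by (simp add: automorphism_def adj_hypercube_iff)
qed

text \<open>The neighbours \<open>e i\<close> of the zero vertex are sent to neighbours of its image, which defines the
  permutation of coordinates; the image of the zero vertex defines the flips. An arbitrary vertex is
  then determined by its distances to the zero vertex and to the \<open>e i\<close>, which \<open>f\<close> preserves.\<close>

lemma hypercube_automorphism_is_permaut:
  assumes f: "automorphism (hypercube n) f"
  obtains \<phi> where "column_permaut n \<phi>" and "\<And>v. length v = n \<Longrightarrow> f v = permaut_vertex n \<phi> v"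
proof -
  have len: "length (f w) = n" if "length w = n" for w
    using f that by (auto simp: automorphism_def dest: bij_betw_apply)
  have f_inj: "u = v" if "f u = f v" "length u = n" "length v = n" for u v
    using f that by (auto simp: automorphism_def bij_betw_def dest: inj_onD)
  define o' :: "bit list" where "o' = replicate n 0"
  define e where "e i = o'[i := 1]" for i
  have lo: "length o' = n" and le: "length (e i) = n" for i by (auto simp: o'_def e_def)
  have "\<exists>!p. p < n \<and> f o' ! p \<noteq> f (e i) ! p" if "i < n" for i
  proof -
    have "\<exists>!p. p < length o' \<and> o' ! p \<noteq> e i ! p"
      using that by (auto simp: e_def o'_def nth_list_update)
    then have "hamming (f o') (f (e i)) = 1"
      using automorphism_hamming[OF f lo le] by (simp only: hamming_eq_1_iff)
    then show ?thesis using len[OF lo] by (simp only: hamming_eq_1_iff)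
  qed
  then obtain p where p: "\<And>i. i < n \<Longrightarrow> p i < n \<and> f o' ! p i \<noteq> f (e i) ! p i"
    "\<And>i q. i < n \<Longrightarrow> q < n \<Longrightarrow> q \<noteq> p i \<Longrightarrow> f o' ! q = f (e i) ! q"
    by metis
  have p_inj: "inj_on p {..<n}"
  proof (rule inj_onI)
    fix i j assume "i \<in> {..<n}" "j \<in> {..<n}" "p i = p j"
    then have ij: "i < n" "j < n" by auto
    have "f (e i) = f (e j)"
    proof (rule nth_equalityI)
      fix q assume "q < length (f (e i))"
      then have "q < n" using len le by simp
      then show "f (e i) ! q = f (e j) ! q"
        using p(1)[OF ij(1)] p(1)[OF ij(2)] p(2)[OF ij(1), of q] p(2)[OF ij(2), of q] \<open>p i = p j\<close>
        by (metis bit_not_zero_iff)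
    qed (simp add: len le)
    then have "e i = e j" using f_inj le by blast
    then show "i = j" using ij unfolding e_def o'_def
      by (metis length_replicate nth_list_update_eq nth_list_update_neq nth_replicate zero_neq_one)
  qed
  define \<pi> where "\<pi> i = (if i < n then p i else i)" for i
  have "bij_betw p {..<n} {..<n}"
    using p_inj p(1) by (simp add: bij_betw_def endo_inj_surj image_subset_iff)
  then have "bij_betw \<pi> {..<n} {..<n}" by (subst bij_betw_cong[of _ \<pi> p]) (auto simp: \<pi>_def)
  then have \<pi>: "\<pi> permutes {..<n}" by (rule bij_imp_permutes) (simp add: \<pi>_def)
  define \<psi> where "\<psi> i = (\<lambda>b. b + f o' ! \<pi> i)" for i
  \<comment> \<open>Compare the distances of \<open>v\<close> to \<open>e i\<close> and to zero, before and after \<open>f\<close>.\<close>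
  have flip: "f v ! p i \<noteq> f o' ! p i \<longleftrightarrow> v ! i = 1" if "length v = n" "i < n" for v i
  proof -
    have "f v ! p i \<noteq> f o' ! p i \<longleftrightarrow> hamming (f v) (f (e i)) < hamming (f v) (f o')"
      using hamming_flip_less_iff[of "f v" n "f o'" "f (e i)" "p i"] p[OF \<open>i < n\<close>] len lo le that
      by metis
    also have "\<dots> \<longleftrightarrow> hamming v (e i) < hamming v o'"
      using automorphism_hamming[OF f] that lo le by simp
    also have "\<dots> \<longleftrightarrow> v ! i \<noteq> o' ! i"
      using that by (intro hamming_flip_less_iff[of _ n]) (auto simp: lo le, auto simp: e_def o'_def)
    finally show ?thesis using that by (simp add: o'_def)
  qed
  have "f v = permaut_vertex n (\<pi>, \<psi>) v" if v: "length v = n" for v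
  proof (rule nth_equalityI)
    fix j assume "j < length (f v)"
    then have j: "j < n" using len v by simp
    define i where "i = inv_into UNIV \<pi> j"
    have i: "i < n" using permutes_in_image[OF permutes_inv[OF \<pi>], of j] j by (simp add: i_def)
    have "j = \<pi> i" unfolding i_def by (simp add: permutes_inverses[OF \<pi>])
    then have ji: "j = p i" using i by (simp add: \<pi>_def)
    have "f v ! j = v ! i + f o' ! j"
      using flip[OF v i] unfolding ji by (cases "v ! i"; cases "f v ! p i"; cases "f o' ! p i") auto
    then show "f v ! j = permaut_vertex n (\<pi>, \<psi>) v ! j"
      using j \<open>j = \<pi> i\<close> by (simp add: permaut_vertex_def \<psi>_def permutes_inverses[OF \<pi>])
  qed (simp add: len that permaut_vertex_def)
  moreover have "column_permaut n (\<pi>, \<psi>)"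
    using \<pi> bij_add_bit by (simp add: column_permaut_def \<psi>_def)
  ultimately show thesis using that by blast
qed

lemma permaut_vertex_eq_id_imp_trivial:
  assumes \<phi>: "column_permaut n \<phi>" and id: "\<And>v. length v = n \<Longrightarrow> permaut_vertex n \<phi> v = v"
  shows "trivial_permaut n \<phi>"
proof -
  obtain \<pi> \<psi> where \<phi>_def: "\<phi> = (\<pi>, \<psi>)" by force
  have \<pi>: "\<pi> permutes {..<n}" and \<psi>: "\<And>i. i < n \<Longrightarrow> bij (\<psi> i)"
    using \<phi> by (auto simp: \<phi>_def column_permaut_def)
  have eq: "\<psi> i (v ! i) = v ! \<pi> i" if "i < n" "length v = n" for i v
  proof -
    have "\<pi> i < n" using permutes_in_image[OF \<pi>, of i] that by simp
    then have "permaut_vertex n \<phi> v ! \<pi> i = \<psi> i (v ! i)"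
      by (simp add: permaut_vertex_def \<phi>_def permutes_inverses[OF \<pi>])
    then show ?thesis using id that by simp
  qed
  have "\<pi> i = i" for i
  proof (cases "i < n")
    case True
    have "\<pi> i < n" using permutes_in_image[OF \<pi>, of i] True by simp
    then show ?thesis
      using eq[OF True, of "replicate n 0"] eq[OF True, of "(replicate n 0)[\<pi> i := 1]"] True
      by (auto simp: nth_list_update split: if_splits)
  next
    case False
    then show ?thesis using \<pi> by (simp add: permutes_def)
  qed
  then have "\<pi> = id" by auto
  moreover have "\<psi> i = id" if "i < n" for i
  proof
    fix b show "\<psi> i b = id b"
      using eq[OF that, of "replicate n b"] that by (simp add: \<open>\<pi> = id\<close>)
  qed
  ultimately show ?thesis by (simp add: \<phi>_def trivial_permaut_def)
qed

section \<open>Distinguishing labelings and asymmetric matrices\<close>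

definition asymmetric_size :: "nat \<Rightarrow> nat \<Rightarrow> bool" where
  "asymmetric_size m n \<longleftrightarrow> (\<exists>X \<in> carrier_mat m n. asymmetric X)"

lemma matrix_symmetry_entry_iff:
  assumes X: "X \<in> carrier_mat m n"
  shows "matrix_symmetry X \<sigma> (\<pi>, \<psi>) \<longleftrightarrow>
    \<sigma> permutes {..<m} \<and> column_permaut n (\<pi>, \<psi>) \<and>
    (\<forall>i<m. \<forall>j<n. X $$ (inv_into UNIV \<sigma> i, j) = \<psi> (inv_into UNIV \<pi> j) (X $$ (i, inv_into UNIV \<pi> j)))"
proof -
  have dim: "dim_row X = m" "dim_col X = n" using X by auto
  have "permute_rows \<sigma> X = apply_permaut (\<pi>, \<psi>) X \<longleftrightarrow>
    (\<forall>i<m. \<forall>j<n. X $$ (inv_into UNIV \<sigma> i, j) = \<psi> (inv_into UNIV \<pi> j) (X $$ (i, inv_into UNIV \<pi> j)))"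
    by (simp add: permute_rows_def apply_permaut_def mat_eq_iff dim)
  then show ?thesis by (simp add: matrix_symmetry_def dim)
qed

definition row_list :: "bit mat \<Rightarrow> nat \<Rightarrow> bit list" where
  "row_list X i = map (\<lambda>j. X $$ (i, j)) [0..<dim_col X]"

text \<open>The bridge between matrices and hypercubes: a symmetry says that the automorphism of the
  hypercube given by the permaut permutes the rows, seen as vertices.\<close>

lemma matrix_symmetry_rows_iff:
  assumes X: "X \<in> carrier_mat m n"
  shows "matrix_symmetry X \<sigma> \<phi> \<longleftrightarrow>
    \<sigma> permutes {..<m} \<and> column_permaut n \<phi> \<and>
    (\<forall>i<m. row_list X (inv_into UNIV \<sigma> i) = permaut_vertex n \<phi> (row_list X i))"
proof (cases \<phi>)
  case (Pair \<pi> \<psi>)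
  have dim: "dim_row X = m" "dim_col X = n" using X by auto
  have "row_list X (inv_into UNIV \<sigma> i) = permaut_vertex n \<phi> (row_list X i) \<longleftrightarrow>
    (\<forall>j<n. X $$ (inv_into UNIV \<sigma> i, j) = \<psi> (inv_into UNIV \<pi> j) (X $$ (i, inv_into UNIV \<pi> j)))"
    if "\<pi> permutes {..<n}" for i
  proof -
    have "inv_into UNIV \<pi> j < n" if "j < n" for j
      using permutes_in_image[OF permutes_inv[OF \<open>\<pi> permutes {..<n}\<close>], of j] that by simp
    then show ?thesis
      by (auto simp: list_eq_iff_nth_eq row_list_def permaut_vertex_def dim Pair)
  qed
  then show ?thesis
    unfolding Pair matrix_symmetry_entry_iff[OF X] by (auto simp: column_permaut_def)
qed

text \<open>Otherwise swapping two equal rows would be a symmetry.\<close>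

lemma asymmetric_rows_distinct:
  assumes X: "X \<in> carrier_mat m n" and "asymmetric X"
  shows "inj_on (row_list X) {..<m}"
proof (rule inj_onI)
  fix a b assume ab: "a \<in> {..<m}" "b \<in> {..<m}" and eq: "row_list X a = row_list X b"
  let ?\<sigma> = "Transposition.transpose a b" and ?\<phi> = "(id, \<lambda>_. id) :: permaut"
  have dim: "dim_row X = m" "dim_col X = n" using X by auto
  have "permaut_vertex n ?\<phi> (row_list X i) = row_list X i" for i
    by (rule nth_equalityI) (auto simp: permaut_vertex_def row_list_def dim)
  moreover have "row_list X (inv_into UNIV ?\<sigma> i) = row_list X i" for i
    using eq by (auto simp: Transposition.transpose_def)
  moreover have "?\<sigma> permutes {..<m}" using ab by (rule permutes_swap_id)
  ultimately have "matrix_symmetry X ?\<sigma> ?\<phi>"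
    by (simp add: matrix_symmetry_rows_iff[OF X] column_permaut_def permutes_id)
  then have "?\<sigma> = id" using assms(2) by (auto simp: asymmetric_def)
  then show "a = b" by (metis id_apply transpose_apply_first)
qed

text \<open>Since there are only two labels, an automorphism preserves the labeling as soon as it preserves
  one class.\<close>

lemma distinguishing2_class_imp_asymmetric:
  assumes c: "distinguishing2 (hypercube n) c" and m: "card (label_class (hypercube n) c b) = m"
  shows "asymmetric_size m n"
proof -
  let ?V = "verts (hypercube n)"
  let ?R = "label_class (hypercube n) c b"
  have R: "v \<in> ?R \<longleftrightarrow> length v = n \<and> c v = b" for v by (simp add: label_class_def)
  have "finite ?R" by (rule rev_finite_subset[OF finite_bit_lists[of n]]) (auto simp: R)
  then obtain r where r: "bij_betw r {..<m} ?R"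
    using ex_bij_betw_nat_finite[of ?R] m by (auto simp: lessThan_atLeast0)
  have r_R: "r i \<in> ?R" if "i < m" for i using r that by (auto dest: bij_betw_apply)
  define X where "X = mat m n (\<lambda>(i, j). r i ! j)"
  have X: "X \<in> carrier_mat m n" by (simp add: X_def)
  have row: "row_list X i = r i" if "i < m" for i
    using r_R[OF that] that by (intro nth_equalityI) (auto simp: R row_list_def X_def)
  have "\<sigma> = id \<and> trivial_permaut n \<phi>" if sym: "matrix_symmetry X \<sigma> \<phi>" for \<sigma> \<phi>
  proof -
    let ?f = "permaut_vertex n \<phi>"
    have \<sigma>: "\<sigma> permutes {..<m}" and \<phi>: "column_permaut n \<phi>"
      using sym by (auto simp: matrix_symmetry_rows_iff[OF X])
    have lt: "inv_into UNIV \<sigma> i < m" if "i < m" for i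
      using permutes_in_image[OF permutes_inv[OF \<sigma>], of i] that by simp
    have f_r: "?f (r i) = r (inv_into UNIV \<sigma> i)" if "i < m" for i
      using sym that lt row by (auto simp: matrix_symmetry_rows_iff[OF X])
    have f: "automorphism (hypercube n) ?f" using \<phi> by (rule permaut_vertex_automorphism)
    then have f_bij: "bij_betw ?f ?V ?V" by (simp only: automorphism_def)
    have sub: "?f ` ?R \<subseteq> ?R"
    proof
      fix w assume "w \<in> ?f ` ?R"
      then obtain i where "i < m" "w = ?f (r i)"
        by (auto simp: bij_betw_imp_surj_on[OF r, symmetric])
      then show "w \<in> ?R" using f_r lt r_R by simp
    qed
    have f_inj: "inj_on ?f ?V" using f_bij by (simp add: bij_betw_def)
    then have "inj_on ?f ?R" by (rule inj_on_subset) (auto simp: R)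
    then have img: "?f ` ?R = ?R" using sub \<open>finite ?R\<close> by (simp add: endo_inj_surj)
    have "c (?f v) = c v" if "v \<in> ?V" for v
    proof (cases "v \<in> ?R")
      case True
      then show ?thesis using img R by (metis imageI)
    next
      case False
      have "?f v \<notin> ?R"
      proof
        assume "?f v \<in> ?R"
        then obtain w where "w \<in> ?R" "?f w = ?f v" using img by (metis imageE)
        then have "w = v" using f_inj that R by (auto dest: inj_onD)
        then show False using \<open>w \<in> ?R\<close> False by simp
      qed
      moreover have "?f v \<in> ?V" using f_bij that by (rule bij_betw_apply)
      ultimately show ?thesis using False that by (auto simp: R)
    qed
    then have "\<forall>v \<in> ?V. ?f v = v" using c f unfolding distinguishing2_def by blast
    then have id: "?f v = v" if "length v = n" for v using that by simp
    then have "trivial_permaut n \<phi>" by (rule permaut_vertex_eq_id_imp_trivial[OF \<phi>])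
    moreover have "inv_into UNIV \<sigma> i = i" for i
    proof (cases "i < m")
      case True
      then have "r (inv_into UNIV \<sigma> i) = r i" using f_r id r_R R by simp
      then show ?thesis using r True lt by (auto simp: bij_betw_def dest: inj_onD)
    next
      case False
      then show ?thesis using permutes_inv[OF \<sigma>] by (simp add: permutes_def)
    qed
    then have "\<sigma> i = i" for i by (metis permutes_inverses(1)[OF \<sigma>])
    ultimately show ?thesis by auto
  qed
  then have "asymmetric X" using X by (simp add: asymmetric_def)
  then show ?thesis using X by (auto simp: asymmetric_size_def)
qed

text \<open>Label the rows of the matrix. An automorphism that preserves the labels permutes the rows and is
  induced by a permaut, and together these form a symmetry of the matrix.\<close>

lemma asymmetric_imp_distinguishing2_class:
  assumes "asymmetric_size m n"
  obtains c where "distinguishing2 (hypercube n) c" "card (label_class (hypercube n) c True) = m"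
proof -
  obtain X where X: "X \<in> carrier_mat m n" and asym: "asymmetric X"
    using assms by (auto simp: asymmetric_size_def)
  let ?V = "verts (hypercube n)"
  let ?r = "row_list X"
  have len: "length (?r i) = n" for i using X by (simp add: row_list_def)
  have inj: "inj_on ?r {..<m}" using X asym by (rule asymmetric_rows_distinct)
  define c where "c v \<longleftrightarrow> v \<in> ?r ` {..<m}" for v
  have "label_class (hypercube n) c True = ?r ` {..<m}"
    using len by (auto simp: label_class_def c_def)
  then have "card (label_class (hypercube n) c True) = m" using inj by (simp add: card_image)
  moreover have "distinguishing2 (hypercube n) c"
    unfolding distinguishing2_def
  proof (intro allI impI, elim conjE)
    fix f assume f: "automorphism (hypercube n) f" and fc: "\<forall>v\<in>?V. c (f v) = c v"
    obtain \<phi> where \<phi>: "column_permaut n \<phi>" and f_\<phi>: "\<And>v. length v = n \<Longrightarrow> f v = permaut_vertex n \<phi> v"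
      using hypercube_automorphism_is_permaut[OF f] by blast
    have "\<exists>k<m. f (?r i) = ?r k" if "i < m" for i
    proof -
      have "c (f (?r i))" using fc len that by (auto simp: c_def)
      then show ?thesis by (auto simp: c_def)
    qed
    then obtain k where k: "\<And>i. i < m \<Longrightarrow> k i < m \<and> f (?r i) = ?r (k i)" by metis
    have f_inj: "u = v" if "f u = f v" "length u = n" "length v = n" for u v
      using f that by (auto simp: automorphism_def bij_betw_def dest: inj_onD)
    have "inj_on k {..<m}"
    proof (rule inj_onI)
      fix i j assume ij: "i \<in> {..<m}" "j \<in> {..<m}" "k i = k j"
      then have "?r i = ?r j" using k f_inj len by (metis lessThan_iff)
      then show "i = j" using inj ij by (auto dest: inj_onD)
    qed
    then have k_bij: "bij_betw k {..<m} {..<m}"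
      using k by (simp add: bij_betw_def endo_inj_surj image_subset_iff)
    define \<tau> where "\<tau> i = (if i < m then k i else i)" for i
    have "bij_betw \<tau> {..<m} {..<m}"
      using k_bij by (subst bij_betw_cong[of _ \<tau> k]) (auto simp: \<tau>_def)
    then have \<tau>: "\<tau> permutes {..<m}" by (rule bij_imp_permutes) (simp add: \<tau>_def)
    have "inv_into UNIV (inv_into UNIV \<tau>) = \<tau>" using permutes_inv_inv[OF \<tau>] .
    moreover have "?r (\<tau> i) = permaut_vertex n \<phi> (?r i)" if "i < m" for i
      using k[OF that] f_\<phi> len that by (simp add: \<tau>_def)
    ultimately have "matrix_symmetry X (inv_into UNIV \<tau>) \<phi>"
      using \<phi> permutes_inv[OF \<tau>] by (simp add: matrix_symmetry_rows_iff[OF X])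
    then have "trivial_permaut n \<phi>" using asym X by (metis asymmetric_def carrier_matD(2))
    then have "permaut_vertex n \<phi> v = v" if "length v = n" for v
      using that by (intro nth_equalityI) (auto simp: trivial_permaut_def permaut_vertex_def)
    then show "\<forall>v\<in>?V. f v = v" using f_\<phi> by simp
  qed
  ultimately show thesis using that by blast
qed

lemma distinguishing2_class_iff_asymmetric:
  "(\<exists>c b. distinguishing2 (hypercube n) c \<and> m = card (label_class (hypercube n) c b)) \<longleftrightarrow>
    asymmetric_size m n"
  using distinguishing2_class_imp_asymmetric asymmetric_imp_distinguishing2_class by metis

lemma cost2_hypercube: "cost2 (hypercube n) = (LEAST m. asymmetric_size m n)"
  unfolding cost2_def distinguishing2_class_iff_asymmetric ..

text \<open>The two classes of one labeling have the same stabilizer, so both give an asymmetric matrix.\<close>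

lemma asymmetric_size_complement_rows:
  assumes "asymmetric_size m n"
  shows "asymmetric_size (2 ^ n - m) n"
proof -
  obtain c where c: "distinguishing2 (hypercube n) c" "card (label_class (hypercube n) c True) = m"
    using assms by (rule asymmetric_imp_distinguishing2_class)
  let ?L = "label_class (hypercube n) c"
  note card_bit_lists[of n]
  moreover have "{v. length v = n} = ?L True \<union> ?L False" "?L True \<inter> ?L False = {}"
    by (auto simp: label_class_def)
  ultimately have "card (?L True) + card (?L False) = 2 ^ n"
    using finite_bit_lists[of n] by (metis card_Un_disjoint finite_Un)
  then have "card (?L False) = 2 ^ n - m" using c(2) by simp
  then show ?thesis using distinguishing2_class_imp_asymmetric[OF c(1)] by blast
qed

section \<open>Rigid collections of column classes\<close>

text \<open>Rows are numbered \<open>0, \<dots>, r\<close>. Of a set of rows and its complement exactly one avoids the last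
  row \<open>r\<close>; it represents the class of a column up to flipping, so the classes are the subsets of
  \<open>{..<r}\<close>.\<close>

definition class_rep :: "nat \<Rightarrow> nat set \<Rightarrow> nat set" where
  "class_rep r D = (if r \<in> D then {..r} - D else D)"

definition rigid :: "nat \<Rightarrow> nat set set \<Rightarrow> bool" where
  "rigid r \<B> \<longleftrightarrow> (\<forall>\<sigma>. \<sigma> permutes {..r} \<and> (\<forall>D\<in>\<B>. class_rep r (\<sigma> ` D) \<in> \<B>) \<longrightarrow> \<sigma> = id)"

definition rigid_size :: "nat \<Rightarrow> nat \<Rightarrow> bool" where
  "rigid_size r n \<longleftrightarrow> (\<exists>\<B> \<subseteq> Pow {..<r}. card \<B> = n \<and> rigid r \<B>)"

lemma class_rep_subset: "D \<subseteq> {..r} \<Longrightarrow> class_rep r D \<subseteq> {..<r}"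
proof -
  have "{..r} = insert r {..<r}" by auto
  then show "D \<subseteq> {..r} \<Longrightarrow> class_rep r D \<subseteq> {..<r}" by (auto simp: class_rep_def)
qed

lemma class_rep_id: "D \<subseteq> {..<r} \<Longrightarrow> class_rep r D = D"
  by (auto simp: class_rep_def)

lemma class_rep_eq_iff:
  assumes "D \<subseteq> {..r}" "D' \<subseteq> {..r}"
  shows "class_rep r D = class_rep r D' \<longleftrightarrow> D' = D \<or> D' = {..r} - D"
proof -
  have "{..r} - ({..r} - D) = D" "{..r} - ({..r} - D') = D'" using assms by blast+
  moreover have "r \<in> {..r} - D \<longleftrightarrow> r \<notin> D" by simp
  ultimately show ?thesis unfolding class_rep_def by metis
qed

lemma image_permutes_subset: "\<sigma> permutes {..r :: nat} \<Longrightarrow> D \<subseteq> {..r} \<Longrightarrow> \<sigma> ` D \<subseteq> {..r}"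
  by (metis image_mono permutes_image)

lemma image_permutes_diff: "\<sigma> permutes {..r :: nat} \<Longrightarrow> \<sigma> ` ({..r} - D) = {..r} - \<sigma> ` D"
  by (simp add: image_set_diff permutes_inj permutes_image)

lemma class_rep_image:
  assumes "\<sigma> permutes {..r}" "D \<subseteq> {..r}"
  shows "class_rep r (\<sigma> ` class_rep r D) = class_rep r (\<sigma> ` D)"
proof (cases "r \<in> D")
  case True
  then have "class_rep r (\<sigma> ` class_rep r D) = class_rep r ({..r} - \<sigma> ` D)"
    by (simp add: class_rep_def[of r D] image_permutes_diff[OF assms(1)])
  then show ?thesis
    using class_rep_eq_iff[of "{..r} - \<sigma> ` D" r "\<sigma> ` D"] image_permutes_subset[OF assms] by auto
qed (simp add: class_rep_def[of r D])

lemma class_rep_image_inj: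
  assumes \<sigma>: "\<sigma> permutes {..r}" and D: "D \<subseteq> {..r}" "D' \<subseteq> {..r}"
    and eq: "class_rep r (\<sigma> ` D) = class_rep r (\<sigma> ` D')"
  shows "class_rep r D = class_rep r D'"
proof -
  have "\<sigma> ` D' = \<sigma> ` D \<or> \<sigma> ` D' = \<sigma> ` ({..r} - D)"
    using eq class_rep_eq_iff[OF image_permutes_subset[OF \<sigma> D(1)] image_permutes_subset[OF \<sigma> D(2)]]
    by (simp add: image_permutes_diff[OF \<sigma>])
  then have "D' = D \<or> D' = {..r} - D"
    by (simp add: inj_image_eq_iff[OF permutes_inj[OF \<sigma>]])
  then show ?thesis using class_rep_eq_iff[OF D] by simp
qed

definition column_set :: "bit mat \<Rightarrow> nat \<Rightarrow> nat set" where
  "column_set X j = {i. i < dim_row X \<and> X $$ (i, j) = 1}"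

lemma class_rep_column_set_eq_iff:
  assumes X: "X \<in> carrier_mat (Suc r) n" and \<sigma>: "\<sigma> permutes {..r}"
  shows "class_rep r (\<sigma> ` column_set X j) = class_rep r (column_set X l) \<longleftrightarrow>
    (\<exists>c. \<forall>i\<le>r. X $$ (inv_into UNIV \<sigma> i, j) = X $$ (i, l) + c)"
proof -
  let ?s = "inv_into UNIV \<sigma>"
  have dim: "dim_row X = Suc r" using X by simp
  have s: "?s i \<le> r \<longleftrightarrow> i \<le> r" for i
    using permutes_in_image[OF permutes_inv[OF \<sigma>], of i] by simp
  have col: "column_set X k \<subseteq> {..r}" for k by (auto simp: column_set_def dim)
  have img: "i \<in> \<sigma> ` column_set X j \<longleftrightarrow> i \<le> r \<and> X $$ (?s i, j) = 1" for i
  proof -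
    have "i \<in> \<sigma> ` column_set X j \<longleftrightarrow> ?s i \<in> column_set X j"
      by (metis imageE imageI permutes_inverses[OF \<sigma>])
    then show ?thesis using s by (simp add: column_set_def dim less_Suc_eq_le)
  qed
  have mem: "i \<in> column_set X l \<longleftrightarrow> i \<le> r \<and> X $$ (i, l) = 1" for i
    by (simp add: column_set_def dim less_Suc_eq_le)
  have bit_cases: "(\<exists>c. P c) \<longleftrightarrow> P 0 \<or> P 1" for P :: "bit \<Rightarrow> bool"
    by (metis bit_not_zero_iff)
  have eq: "(i \<in> column_set X l \<longleftrightarrow> i \<in> \<sigma> ` column_set X j) \<longleftrightarrow>
      (i \<le> r \<longrightarrow> X $$ (?s i, j) = X $$ (i, l) + 0)" for i
    unfolding img mem by (cases "X $$ (?s i, j)"; cases "X $$ (i, l)") auto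
  have eq_compl: "(i \<in> column_set X l \<longleftrightarrow> i \<in> {..r} - \<sigma> ` column_set X j) \<longleftrightarrow>
      (i \<le> r \<longrightarrow> X $$ (?s i, j) = X $$ (i, l) + 1)" for i
    unfolding Diff_iff atMost_iff img mem by (cases "X $$ (?s i, j)"; cases "X $$ (i, l)") auto
  have "class_rep r (\<sigma> ` column_set X j) = class_rep r (column_set X l) \<longleftrightarrow>
    column_set X l = \<sigma> ` column_set X j \<or> column_set X l = {..r} - \<sigma> ` column_set X j"
    by (intro class_rep_eq_iff image_permutes_subset[OF \<sigma>] col)
  also have "column_set X l = \<sigma> ` column_set X j \<longleftrightarrow>
      (\<forall>i\<le>r. X $$ (?s i, j) = X $$ (i, l) + 0)"
    unfolding Set.set_eq_iff eq ..
  also have "column_set X l = {..r} - \<sigma> ` column_set X j \<longleftrightarrow>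
      (\<forall>i\<le>r. X $$ (?s i, j) = X $$ (i, l) + 1)"
    unfolding Set.set_eq_iff eq_compl ..
  finally show ?thesis unfolding bit_cases .
qed

text \<open>The bit flips of a permaut can be chosen separately for every column, so only the permutations of
  rows and columns remain, acting on columns up to complement.\<close>

lemma matrix_symmetry_columns_iff:
  assumes X: "X \<in> carrier_mat (Suc r) n"
  shows "(\<exists>\<psi>. matrix_symmetry X \<sigma> (\<pi>, \<psi>)) \<longleftrightarrow> \<sigma> permutes {..r} \<and> \<pi> permutes {..<n} \<and>
    (\<forall>j<n. class_rep r (\<sigma> ` column_set X j) = class_rep r (column_set X (inv_into UNIV \<pi> j)))"
    (is "?L \<longleftrightarrow> ?R")
proof
  assume ?L
  then obtain \<psi> where sym: "matrix_symmetry X \<sigma> (\<pi>, \<psi>)" by blast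
  have \<sigma>: "\<sigma> permutes {..r}" and \<pi>: "\<pi> permutes {..<n}" and \<psi>: "\<And>l. l < n \<Longrightarrow> bij (\<psi> l)"
    using sym by (auto simp: matrix_symmetry_entry_iff[OF X] column_permaut_def lessThan_Suc_atMost)
  have "class_rep r (\<sigma> ` column_set X j) = class_rep r (column_set X (inv_into UNIV \<pi> j))"
    if j: "j < n" for j
  proof -
    have "inv_into UNIV \<pi> j < n" using permutes_in_image[OF permutes_inv[OF \<pi>], of j] j by simp
    then obtain c where "\<psi> (inv_into UNIV \<pi> j) = (\<lambda>b. b + c)" using \<psi> bij_bitE by metis
    then show ?thesis
      using sym j unfolding matrix_symmetry_entry_iff[OF X] class_rep_column_set_eq_iff[OF X \<sigma>]
      by (auto simp: less_Suc_eq_le)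
  qed
  then show ?R using \<sigma> \<pi> by blast
next
  assume R: ?R
  then have \<sigma>: "\<sigma> permutes {..r}" and \<pi>: "\<pi> permutes {..<n}" by auto
  have "\<exists>c. \<forall>i\<le>r. X $$ (inv_into UNIV \<sigma> i, j) = X $$ (i, inv_into UNIV \<pi> j) + c" if "j < n" for j
    using R that by (auto simp: class_rep_column_set_eq_iff[OF X \<sigma>])
  then obtain c where c: "\<And>j i. j < n \<Longrightarrow> i \<le> r \<Longrightarrow>
      X $$ (inv_into UNIV \<sigma> i, j) = X $$ (i, inv_into UNIV \<pi> j) + c j"
    by metis
  have "matrix_symmetry X \<sigma> (\<pi>, \<lambda>l b. b + c (\<pi> l))"
    unfolding matrix_symmetry_entry_iff[OF X]
    using \<sigma> \<pi> c bij_add_bit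
    by (simp add: column_permaut_def lessThan_Suc_atMost less_Suc_eq_le permutes_inverses[OF \<pi>])
  then show ?L by blast
qed

text \<open>Two columns in the same class could be exchanged by a permaut, and a permutation of the rows that
  preserves the collection of classes is completed to a symmetry by the permutation that it induces
  on the columns.\<close>

lemma asymmetric_imp_rigid:
  assumes X: "X \<in> carrier_mat (Suc r) n" and asym: "asymmetric X"
  defines "\<kappa> \<equiv> \<lambda>j. class_rep r (column_set X j)"
  shows "inj_on \<kappa> {..<n}" "rigid r (\<kappa> ` {..<n})" "\<kappa> ` {..<n} \<subseteq> Pow {..<r}"
proof -
  have dim: "dim_row X = Suc r" using X by simp
  have col: "column_set X k \<subseteq> {..r}" for k by (auto simp: column_set_def dim)
  show "\<kappa> ` {..<n} \<subseteq> Pow {..<r}"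
    unfolding \<kappa>_def using class_rep_subset[OF col] by blast
  have id: "\<sigma> = id \<and> \<pi> = id" if "\<sigma> permutes {..r}" "\<pi> permutes {..<n}"
    "\<And>j. j < n \<Longrightarrow> class_rep r (\<sigma> ` column_set X j) = \<kappa> (inv_into UNIV \<pi> j)" for \<sigma> \<pi>
  proof -
    have "\<sigma> permutes {..r} \<and> \<pi> permutes {..<n} \<and> (\<forall>j<n. class_rep r (\<sigma> ` column_set X j) =
        class_rep r (column_set X (inv_into UNIV \<pi> j)))"
      using that unfolding \<kappa>_def by simp
    then obtain \<psi> where "matrix_symmetry X \<sigma> (\<pi>, \<psi>)"
      unfolding matrix_symmetry_columns_iff[OF X, symmetric] by blast
    then have "\<sigma> = id \<and> trivial_permaut (dim_col X) (\<pi>, \<psi>)"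
      using asym unfolding asymmetric_def by blast
    then show ?thesis by (simp add: trivial_permaut_def)
  qed
  show inj: "inj_on \<kappa> {..<n}"
  proof (rule inj_onI)
    fix a b assume ab: "a \<in> {..<n}" "b \<in> {..<n}" and eq: "\<kappa> a = \<kappa> b"
    have "Transposition.transpose a b permutes {..<n}" using ab by (rule permutes_swap_id)
    moreover have "class_rep r (id ` column_set X j) =
        \<kappa> (inv_into UNIV (Transposition.transpose a b) j)" for j
      using eq by (auto simp: Transposition.transpose_def \<kappa>_def)
    ultimately have "Transposition.transpose a b = id" using id permutes_id by blast
    then show "a = b" by (metis id_apply transpose_apply_first)
  qed
  show "rigid r (\<kappa> ` {..<n})"
    unfolding rigid_def
  proof (intro allI impI, elim conjE)
    fix \<sigma> assume \<sigma>: "\<sigma> permutes {..r}" and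
      pres: "\<forall>D\<in>\<kappa> ` {..<n}. class_rep r (\<sigma> ` D) \<in> \<kappa> ` {..<n}"
    have "\<exists>l<n. class_rep r (\<sigma> ` column_set X j) = \<kappa> l" if "j < n" for j
    proof -
      have "class_rep r (\<sigma> ` \<kappa> j) \<in> \<kappa> ` {..<n}" using pres that by simp
      then show ?thesis unfolding \<kappa>_def class_rep_image[OF \<sigma> col] by auto
    qed
    then obtain p where p: "\<And>j. j < n \<Longrightarrow> p j < n \<and> class_rep r (\<sigma> ` column_set X j) = \<kappa> (p j)"
      by metis
    have "inj_on p {..<n}"
    proof (rule inj_onI)
      fix a b assume ab: "a \<in> {..<n}" "b \<in> {..<n}" "p a = p b"
      then have "class_rep r (\<sigma> ` column_set X a) = class_rep r (\<sigma> ` column_set X b)"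
        using p by simp
      then have "\<kappa> a = \<kappa> b" unfolding \<kappa>_def by (rule class_rep_image_inj[OF \<sigma> col col])
      then show "a = b" using inj ab by (auto dest: inj_onD)
    qed
    then have p_bij: "bij_betw p {..<n} {..<n}"
      using p by (simp add: bij_betw_def endo_inj_surj image_subset_iff)
    define \<tau> where "\<tau> i = (if i < n then p i else i)" for i
    have "bij_betw \<tau> {..<n} {..<n}"
      using p_bij by (subst bij_betw_cong[of _ \<tau> p]) (auto simp: \<tau>_def)
    then have \<tau>: "\<tau> permutes {..<n}" by (rule bij_imp_permutes) (simp add: \<tau>_def)
    have "inv_into UNIV (inv_into UNIV \<tau>) = \<tau>" using permutes_inv_inv[OF \<tau>] .
    then show "\<sigma> = id"
      using id[OF \<sigma> permutes_inv[OF \<tau>]] p by (simp add: \<tau>_def)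
  qed
qed

text \<open>In a symmetry the row permutation preserves the collection and is therefore trivial; the columns
  represent different classes, so the column permutation is trivial as well. No bit is flipped, since
  the last row is zero.\<close>

lemma rigid_imp_asymmetric:
  assumes \<B>: "\<B> \<subseteq> Pow {..<r}" "card \<B> = n" and rigid: "rigid r \<B>"
  shows "asymmetric_size (Suc r) n"
proof -
  have "finite \<B>" using \<B>(1) by (rule finite_subset) simp
  then obtain e where e: "bij_betw e {..<n} \<B>"
    using ex_bij_betw_nat_finite[of \<B>] \<B>(2) by (auto simp: lessThan_atLeast0)
  have e_sub: "e j \<subseteq> {..<r}" if "j < n" for j
    using e \<B>(1) that by (auto dest!: bij_betw_apply)
  define X :: "bit mat" where "X = mat (Suc r) n (\<lambda>(i, j). of_bool (i \<in> e j))"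
  have X: "X \<in> carrier_mat (Suc r) n" by (simp add: X_def)
  have col: "column_set X j = e j" if "j < n" for j
    using e_sub[OF that] that by (auto simp: column_set_def X_def)
  have "\<sigma> = id \<and> trivial_permaut n \<phi>" if sym: "matrix_symmetry X \<sigma> \<phi>" for \<sigma> \<phi>
  proof -
    obtain \<pi> \<psi> where \<phi>: "\<phi> = (\<pi>, \<psi>)" by force
    have \<sigma>: "\<sigma> permutes {..r}" and \<pi>: "\<pi> permutes {..<n}" and
      cols: "\<And>j. j < n \<Longrightarrow>
        class_rep r (\<sigma> ` column_set X j) = class_rep r (column_set X (inv_into UNIV \<pi> j))"
      using sym matrix_symmetry_columns_iff[OF X] unfolding \<phi> by blast+
    have lt: "inv_into UNIV \<pi> j < n" if "j < n" for j
      using permutes_in_image[OF permutes_inv[OF \<pi>], of j] that by simp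
    have cols': "class_rep r (\<sigma> ` e j) = e (inv_into UNIV \<pi> j)" if "j < n" for j
      using cols[OF that] class_rep_id[OF e_sub[OF lt[OF that]]] by (simp add: col that lt)
    have "class_rep r (\<sigma> ` D) \<in> \<B>" if "D \<in> \<B>" for D
    proof -
      have "D \<in> e ` {..<n}" using that by (simp only: bij_betw_imp_surj_on[OF e])
      then obtain j where "j < n" "D = e j" by (elim imageE) simp
      then show ?thesis using cols' lt e by (auto dest: bij_betw_apply)
    qed
    then have "\<sigma> = id" using rigid \<sigma> by (auto simp: rigid_def)
    have "e j = e (inv_into UNIV \<pi> j)" if "j < n" for j
      using cols'[OF that] class_rep_id[OF e_sub[OF that]] by (simp add: \<open>\<sigma> = id\<close>)
    then have "inv_into UNIV \<pi> j = j" if "j < n" for j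
      using e that lt by (metis bij_betw_def inj_onD lessThan_iff)
    then have "inv_into UNIV \<pi> j = j" for j
      using permutes_inv[OF \<pi>] by (cases "j < n") (auto simp: permutes_def)
    then have "\<pi> j = j" for j by (metis permutes_inverses(1)[OF \<pi>])
    then have "\<pi> = id" by auto
    have "\<psi> j = id" if j: "j < n" for j
    proof -
      have "bij (\<psi> j)" using sym j by (auto simp: \<phi> matrix_symmetry_entry_iff[OF X] column_permaut_def)
      then obtain c where c: "\<psi> j = (\<lambda>b. b + c)" by (rule bij_bitE)
      have "X $$ (r, j) = \<psi> j (X $$ (r, j))"
        using sym j by (auto simp: \<phi> matrix_symmetry_entry_iff[OF X] \<open>\<sigma> = id\<close> \<open>\<pi> = id\<close>)
      then have "c = 0" unfolding c by (metis add_left_cancel add_0_right)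
      then show ?thesis using c by auto
    qed
    then show ?thesis by (simp add: \<phi> trivial_permaut_def \<open>\<sigma> = id\<close> \<open>\<pi> = id\<close>)
  qed
  then have "asymmetric X" using X by (simp add: asymmetric_def)
  then show ?thesis using X by (auto simp: asymmetric_size_def)
qed

lemma asymmetric_size_Suc_iff: "asymmetric_size (Suc r) n \<longleftrightarrow> rigid_size r n"
proof
  assume "asymmetric_size (Suc r) n"
  then obtain X where "X \<in> carrier_mat (Suc r) n" "asymmetric X" by (auto simp: asymmetric_size_def)
  from asymmetric_imp_rigid[OF this] show "rigid_size r n"
    unfolding rigid_size_def by (metis card_image card_lessThan)
qed (auto simp: rigid_size_def intro: rigid_imp_asymmetric)

text \<open>An empty column equals its own flip, which is therefore a nontrivial symmetry.\<close>

lemma not_asymmetric_size_0: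
  assumes "0 < n"
  shows "\<not> asymmetric_size 0 n"
proof
  assume "asymmetric_size 0 n"
  then obtain X where X: "X \<in> carrier_mat 0 n" and asym: "asymmetric X"
    by (auto simp: asymmetric_size_def)
  have "matrix_symmetry X id (id, \<lambda>_ b. b + 1)"
    by (simp add: matrix_symmetry_entry_iff[OF X] column_permaut_def bij_add_bit permutes_id del: add_bit_eq_xor)
  then have "trivial_permaut n (id, \<lambda>_ b. b + 1)"
    using asym X by (metis asymmetric_def carrier_matD(2))
  then have "(\<lambda>b :: bit. b + 1) = id" using assms by (auto simp: trivial_permaut_def)
  from fun_cong[OF this, of 0] show False by simp
qed

section \<open>Extending and complementing rigid collections\<close>

lemma subset_lessThan_imp_atMost: "D \<subseteq> {..<r :: nat} \<Longrightarrow> D \<subseteq> {..r}"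
  by (rule subset_trans[of D "{..<r}"]) auto

lemma rigidI:
  assumes "\<And>\<sigma>. \<sigma> permutes {..r} \<Longrightarrow> (\<And>D. D \<in> \<B> \<Longrightarrow> class_rep r (\<sigma> ` D) \<in> \<B>) \<Longrightarrow> \<sigma> = id"
  shows "rigid r \<B>"
  using assms unfolding rigid_def by blast

lemma rigidD:
  assumes "rigid r \<B>" "\<sigma> permutes {..r}" "\<And>D. D \<in> \<B> \<Longrightarrow> class_rep r (\<sigma> ` D) \<in> \<B>"
  shows "\<sigma> = id"
  using assms unfolding rigid_def by blast

lemma rigid_size_le:
  assumes "rigid_size r n"
  shows "n \<le> 2 ^ r"
proof -
  obtain \<B> where "\<B> \<subseteq> Pow {..<r}" "card \<B> = n" using assms by (auto simp: rigid_size_def)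
  then have "n \<le> card (Pow {..<r})" by (metis card_mono finite_Pow_iff finite_lessThan)
  then show ?thesis by (simp add: card_Pow)
qed

text \<open>A row permutation acts injectively on the finite set of all classes, so it preserves a collection
  as soon as it preserves the complement.\<close>

lemma rigid_size_complement:
  assumes "rigid_size r n"
  shows "rigid_size r (2 ^ r - n)"
proof -
  obtain \<B> where \<B>: "\<B> \<subseteq> Pow {..<r}" "card \<B> = n" and rigid: "rigid r \<B>"
    using assms by (auto simp: rigid_size_def)
  have fin: "finite \<B>" using \<B>(1) by (rule finite_subset) simp
  let ?C = "Pow {..<r} - \<B>"
  have "rigid r ?C"
  proof (rule rigidI)
    fix \<sigma> assume \<sigma>: "\<sigma> permutes {..r}" and pres: "\<And>D. D \<in> ?C \<Longrightarrow> class_rep r (\<sigma> ` D) \<in> ?C"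
    let ?act = "\<lambda>D. class_rep r (\<sigma> ` D)"
    have sub: "D \<subseteq> {..r}" if "D \<in> Pow {..<r}" for D
      using that subset_lessThan_imp_atMost by simp
    have inj: "inj_on ?act (Pow {..<r})"
    proof (rule inj_onI)
      fix D D' assume D: "D \<in> Pow {..<r}" "D' \<in> Pow {..<r}" and eq: "?act D = ?act D'"
      have "class_rep r D = class_rep r D'"
        by (rule class_rep_image_inj[OF \<sigma> sub[OF D(1)] sub[OF D(2)] eq])
      then show "D = D'" using D by (simp add: class_rep_id)
    qed
    have into: "?act D \<in> Pow {..<r}" if "D \<in> Pow {..<r}" for D
      using class_rep_subset[OF image_permutes_subset[OF \<sigma> sub[OF that]]] by simp
    have "?act ` ?C = ?C"
    proof (rule endo_inj_surj)
      show "?act ` ?C \<subseteq> ?C" using pres by (rule image_subsetI)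
      show "inj_on ?act ?C" using inj by (rule inj_on_subset) (rule Diff_subset)
    qed simp
    have "?act D \<in> \<B>" if "D \<in> \<B>" for D
    proof (rule ccontr)
      assume "?act D \<notin> \<B>"
      then have "?act D \<in> ?act ` ?C" using into that \<B>(1) unfolding \<open>?act ` ?C = ?C\<close> by blast
      then obtain D' where "D' \<in> ?C" "?act D = ?act D'" by (elim imageE)
      then have "D = D'" using inj_onD[OF inj, of D D'] that \<B>(1) by blast
      then show False using that \<open>D' \<in> ?C\<close> by blast
    qed
    then show "\<sigma> = id" by (rule rigidD[OF rigid \<sigma>])
  qed
  moreover have "card ?C = 2 ^ r - n" using \<B> fin by (simp add: card_Diff_subset card_Pow)
  moreover have "?C \<subseteq> Pow {..<r}" by (rule Diff_subset)
  ultimately show ?thesis unfolding rigid_size_def by metis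
qed

definition class_weight :: "nat \<Rightarrow> nat set \<Rightarrow> nat" where
  "class_weight r D = min (card D) (Suc r - card D)"

lemma class_weight_image:
  assumes \<sigma>: "\<sigma> permutes {..r}" and D: "D \<subseteq> {..r}"
  shows "class_weight r (class_rep r (\<sigma> ` D)) = class_weight r D"
proof -
  have card: "card (\<sigma> ` D) = card D" by (simp add: card_image permutes_inj_on[OF \<sigma>])
  have "card D \<le> Suc r" using card_mono[OF _ D] by simp
  moreover have "card ({..r} - \<sigma> ` D) = Suc r - card D"
    using image_permutes_subset[OF \<sigma> D] by (simp add: card_Diff_subset finite_subset card)
  ultimately show ?thesis by (auto simp: class_weight_def class_rep_def card)
qed

text \<open>The \<open>n\<close> classes cannot have all of the \<open>Suc r div 2 + 1\<close> possible weights. A new class of a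
  missing weight cannot be the image of an old one, so every symmetry of the enlarged collection
  preserves the old one.\<close>

lemma rigid_size_Suc:
  assumes "rigid_size r n" and n: "n \<le> Suc r div 2" and r: "1 \<le> r"
  shows "rigid_size r (Suc n)"
proof -
  obtain \<B> where \<B>: "\<B> \<subseteq> Pow {..<r}" "card \<B> = n" and rigid: "rigid r \<B>"
    using assms by (auto simp: rigid_size_def)
  have fin: "finite \<B>" using \<B>(1) by (rule finite_subset) simp
  have "card (class_weight r ` \<B>) \<le> n" using card_image_le[OF fin] \<B>(2) by simp
  then have "\<not> {..Suc r div 2} \<subseteq> class_weight r ` \<B>"
    using n card_mono[of "class_weight r ` \<B>" "{..Suc r div 2}"] fin by auto
  then obtain w where w: "w \<le> Suc r div 2" "w \<notin> class_weight r ` \<B>" by auto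
  define D where "D = {..<w}"
  have D: "D \<subseteq> {..<r}" "class_weight r D = w" using w r by (auto simp: D_def class_weight_def)
  have "rigid r (insert D \<B>)"
  proof (rule rigidI)
    fix \<sigma> assume \<sigma>: "\<sigma> permutes {..r}" and
      pres: "\<And>E. E \<in> insert D \<B> \<Longrightarrow> class_rep r (\<sigma> ` E) \<in> insert D \<B>"
    have "class_rep r (\<sigma> ` E) \<in> \<B>" if "E \<in> \<B>" for E
    proof -
      have "E \<subseteq> {..r}" using that \<B>(1) subset_lessThan_imp_atMost by blast
      then have "class_weight r (class_rep r (\<sigma> ` E)) = class_weight r E"
        by (rule class_weight_image[OF \<sigma>])
      then have "class_rep r (\<sigma> ` E) \<noteq> D" using D(2) w(2) that by auto
      then show ?thesis using pres[of E] that by auto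
    qed
    then show "\<sigma> = id" by (rule rigidD[OF rigid \<sigma>])
  qed
  moreover have "D \<notin> \<B>" using D(2) w(2) by auto
  ultimately show ?thesis
    using \<B> D(1) fin unfolding rigid_size_def by (intro exI[of _ "insert D \<B>"]) auto
qed

section \<open>Rigidity of paths\<close>

text \<open>The edges of the path on the rows \<open>0, \<dots>, k - 1\<close>, where edge \<open>i\<close> is enlarged by the private row
  \<open>k + i\<close> as long as this stays below the last row \<open>r\<close>. For \<open>k \<le> r\<close> row \<open>r\<close> is isolated, and \<open>k = r\<close>
  gives the plain path.\<close>

definition chain_set :: "nat \<Rightarrow> nat \<Rightarrow> nat \<Rightarrow> nat set" where
  "chain_set r k i = {i, Suc i} \<union> (if k + i < r then {k + i} else {})"

lemma inj_on_chain_set: "inj_on (chain_set r k) {..<k - 1}"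
proof (rule inj_onI)
  fix a b assume ab: "a \<in> {..<k - 1}" "b \<in> {..<k - 1}" and eq: "chain_set r k a = chain_set r k b"
  have mem: "i \<in> chain_set r k i" for i by (simp add: chain_set_def)
  have "a \<in> chain_set r k b" "b \<in> chain_set r k a" using mem[of a] mem[of b] eq by simp_all
  then show "a = b" using ab by (auto simp: chain_set_def split: if_splits)
qed

text \<open>Walk along the path from its fixed end. If row \<open>i\<close> and edge \<open>i\<close> are fixed, then row \<open>Suc i\<close>
  is the only other row of edge \<open>i\<close> that lies in a second edge, so it is fixed, and so is that
  second edge. The bound \<open>r \<le> 2 * k - 2\<close> keeps the last edge free of a private row, which could be
  exchanged with the end of the path.\<close>

lemma chain_rigid:
  assumes \<sigma>: "\<sigma> permutes {..r}" and k: "2 \<le> k" "k \<le> r" "r \<le> 2 * k - 2" and zero: "\<sigma> 0 = 0"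
    and pres: "\<And>i. i < k - 1 \<Longrightarrow> \<sigma> ` chain_set r k i \<in> chain_set r k ` {..<k - 1}"
  shows "\<sigma> = id"
proof -
  let ?C = "chain_set r k"
  have inj: "inj \<sigma>" using \<sigma> by (rule permutes_inj)
  have "\<exists>j<k - 1. \<sigma> ` ?C i = ?C j" if "i < k - 1" for i using pres[OF that] by auto
  then obtain f where f: "\<And>i. i < k - 1 \<Longrightarrow> f i < k - 1 \<and> \<sigma> ` ?C i = ?C (f i)" by metis
  have f_inj: "i = j" if "f i = f j" "i < k - 1" "j < k - 1" for i j
  proof -
    have "\<sigma> ` ?C i = \<sigma> ` ?C j" using f that by simp
    then have "?C i = ?C j" using inj by (simp add: inj_image_eq_iff)
    then show ?thesis using inj_onD[OF inj_on_chain_set] that by auto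
  qed
  have mem: "x \<in> ?C j \<longleftrightarrow> x = j \<or> x = Suc j \<or> (x = k + j \<and> k + j < r)" for x j
    by (auto simp: chain_set_def)
  have img: "\<sigma> x \<in> ?C (f i)" if "x \<in> ?C i" "i < k - 1" for x i
    using f[OF that(2)] that(1) by blast
  have fixed: "i < k - 1 \<longrightarrow> \<sigma> i = i \<and> f i = i" for i
  proof (induction i)
    case 0
    show ?case
    proof
      assume "0 < k - 1"
      then have "\<sigma> 0 \<in> ?C (f 0)" by (intro img) (simp_all add: mem)
      then show "\<sigma> 0 = 0 \<and> f 0 = 0" using zero k(1) by (simp add: mem)
    qed
  next
    case (Suc i)
    show ?case
    proof
      assume i: "Suc i < k - 1"
      then have IH: "\<sigma> i = i" "f i = i" using Suc by auto
      have lt: "f (Suc i) < k - 1" and ne: "f (Suc i) \<noteq> i"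
        using f[OF i] f_inj[of "Suc i" i] IH i by auto
      have "\<sigma> (Suc i) \<in> ?C i" using img[of "Suc i" i] i IH by (simp add: mem)
      moreover have "\<sigma> (Suc i) \<in> ?C (f (Suc i))" using i by (intro img) (simp_all add: mem)
      moreover have "\<sigma> (Suc i) \<noteq> i" using inj IH by (metis injD n_not_Suc_n)
      ultimately have "\<sigma> (Suc i) = Suc i" "f (Suc i) = Suc i"
        using lt ne i by (auto simp: mem)
      then show "\<sigma> (Suc i) = Suc i \<and> f (Suc i) = Suc i" ..
    qed
  qed
  have last: "\<sigma> (k - 1) = k - 1"
  proof -
    let ?i = "k - 2"
    have i: "?i < k - 1" "Suc ?i = k - 1" using k by auto
    then have "\<sigma> (k - 1) \<in> ?C ?i" using img[of "k - 1" ?i] fixed[of ?i] by (simp add: mem)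
    moreover have "\<not> k + ?i < r" using k by auto
    moreover have "\<sigma> (k - 1) \<noteq> ?i" using inj fixed[of ?i] i by (metis injD less_irrefl)
    ultimately show ?thesis using i by (auto simp: mem)
  qed
  have pendant: "\<sigma> (k + i) = k + i" if "k + i < r" for i
  proof -
    have i: "i < k - 1" using that k by auto
    then have "\<sigma> (k + i) \<in> ?C i" using img[of "k + i" i] fixed[of i] that by (simp add: mem)
    moreover have "\<sigma> (k + i) \<noteq> \<sigma> i" "\<sigma> (k + i) \<noteq> \<sigma> (Suc i)" using inj i by (auto simp: inj_eq)
    moreover have "\<sigma> (Suc i) = Suc i" using fixed[of "Suc i"] last i by (cases "Suc i = k - 1") auto
    ultimately show ?thesis using fixed[of i] i by (auto simp: mem)
  qed
  have lt: "\<sigma> x = x" if "x < r" for x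
  proof -
    consider "x < k - 1" | "x = k - 1" | "k \<le> x" by linarith
    then show ?thesis using fixed last pendant[of "x - k"] that by cases auto
  qed
  have "\<sigma> r = r"
  proof -
    have "\<sigma> r \<le> r" using permutes_in_image[OF \<sigma>, of r] by simp
    moreover have "\<not> \<sigma> r < r" using lt inj by (metis injD less_irrefl)
    ultimately show ?thesis by simp
  qed
  then have "\<sigma> x = x" for x using lt \<sigma> by (cases x r rule: linorder_cases) (auto simp: permutes_def)
  then show ?thesis by auto
qed

text \<open>Edges have two or three rows, the marked end has one, and with at least seven rows all complements
  are larger; hence a symmetry maps edges to edges and fixes the marked end.\<close>

lemma rigid_size_thick_path:
  assumes r: "6 \<le> r" and k: "k \<le> r" "r \<le> 2 * k - 2"
  shows "rigid_size r k"
proof -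
  let ?C = "chain_set r k"
  let ?\<B> = "insert {0} (?C ` {..<k - 1})"
  have k2: "2 \<le> k" using r k by auto
  have card_C: "2 \<le> card (?C i) \<and> card (?C i) \<le> 3" if "i < k - 1" for i
    using that k2 by (auto simp: chain_set_def card_insert_if)
  have C_sub: "?C i \<subseteq> {..<r}" if "i < k - 1" for i
    using that k by (auto simp: chain_set_def)
  have sub: "?\<B> \<subseteq> Pow {..<r}" using C_sub r by auto
  have single: "D \<noteq> ?C i" if "card D = 1" "i < k - 1" for D i using card_C[of i] that by auto
  have notin: "{0} \<notin> ?C ` {..<k - 1}" using single[of "{0}"] by (simp add: image_iff)
  have "card (?C ` {..<k - 1}) = k - 1" using card_image[OF inj_on_chain_set] by (simp only: card_lessThan)
  then have "card ?\<B> = k" using notin k2 by simp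
  moreover have "rigid r ?\<B>"
  proof (rule rigidI)
    fix \<sigma> assume \<sigma>: "\<sigma> permutes {..r}" and
      pres: "\<And>D. D \<in> ?\<B> \<Longrightarrow> class_rep r (\<sigma> ` D) \<in> ?\<B>"
    have small: "card D \<le> 3" if "D \<in> ?\<B>" for D
      using that by (elim insertE imageE) (simp_all add: card_C)
    \<comment> \<open>No complement needs to be taken: the image itself belongs to the collection.\<close>
    have stays: "\<sigma> ` D \<in> ?\<B>" if "D \<in> ?\<B>" for D
    proof -
      have "D \<subseteq> {..r}" using sub that subset_lessThan_imp_atMost by blast
      then have "card ({..r} - \<sigma> ` D) = Suc r - card D"
        using image_permutes_subset[OF \<sigma>, of D]
        by (simp add: card_Diff_subset finite_subset card_image permutes_inj_on[OF \<sigma>])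
      then have "3 < card ({..r} - \<sigma> ` D)" using small[OF that] r by linarith
      then have "{..r} - \<sigma> ` D \<notin> ?\<B>" using small[of "{..r} - \<sigma> ` D"] by linarith
      then show ?thesis using pres[OF that] unfolding class_rep_def by metis
    qed
    have card_img: "card (\<sigma> ` D) = card D" for D by (simp add: card_image permutes_inj_on[OF \<sigma>])
    have "\<sigma> ` {0} \<in> ?\<B>" by (rule stays) simp
    moreover have "\<sigma> ` {0} \<noteq> ?C i" if "i < k - 1" for i
      using single[OF _ that] card_img[of "{0}"] by simp
    ultimately have "\<sigma> 0 = 0" by (simp add: image_iff)
    moreover have "\<sigma> ` ?C i \<in> ?C ` {..<k - 1}" if "i < k - 1" for i
    proof -
      have "card (\<sigma> ` ?C i) \<noteq> card {0 :: nat}" using card_C[OF that] card_img[of "?C i"] by simp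
      then have "\<sigma> ` ?C i \<noteq> {0}" by metis
      moreover have "\<sigma> ` ?C i \<in> ?\<B>" 
        by (rule stays, rule insertI2, rule imageI) (use that in simp)
      ultimately show ?thesis by (simp only: insert_iff simp_thms)
    qed
    ultimately show "\<sigma> = id" by (rule chain_rigid[OF \<sigma> k2 k])
  qed
  ultimately show ?thesis unfolding rigid_size_def using sub by metis
qed

text \<open>The classes of weight two are the edges of the path, so a symmetry acts on the path. It maps
  row \<open>0\<close>, which lies in a single edge, to one of the two ends; but the singleton of row \<open>0\<close> belongs to the
  collection and that of the other end does not.\<close>

lemma path_rigid:
  assumes r: "4 \<le> r" and \<B>: "\<B> \<subseteq> Pow {..<r}"
    and base: "{0} \<in> \<B>" "chain_set r r ` {..<r - 1} \<subseteq> \<B>" and last: "{r - 1} \<notin> \<B>"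
    and weight2: "\<And>D. D \<in> \<B> \<Longrightarrow> class_weight r D = 2 \<Longrightarrow> D \<in> chain_set r r ` {..<r - 1}"
  shows "rigid r \<B>"
proof (rule rigidI)
  fix \<sigma> assume \<sigma>: "\<sigma> permutes {..r}" and pres: "\<And>D. D \<in> \<B> \<Longrightarrow> class_rep r (\<sigma> ` D) \<in> \<B>"
  let ?C = "chain_set r r"
  let ?P = "?C ` {..<r - 1}"
  have inj: "inj \<sigma>" using \<sigma> by (rule permutes_inj)
  have edge: "?C i = {i, Suc i}" for i by (simp add: chain_set_def)
  have card_edge: "card D = 2" if "D \<in> ?P" for D using that by (auto simp: edge)
  have edge_sub: "D \<subseteq> {..<r}" if "D \<in> ?P" for D using that by (auto simp: edge)
  have maps: "\<sigma> ` D \<in> ?P" if D: "D \<in> ?P" for D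
  proof -
    have sub: "D \<subseteq> {..r}" using edge_sub[OF D] by (rule subset_lessThan_imp_atMost)
    have card_img: "card (\<sigma> ` D) = 2"
      using card_edge[OF D] by (simp add: card_image permutes_inj_on[OF \<sigma>])
    have "class_weight r D = 2" using card_edge[OF D] r by (simp add: class_weight_def)
    then have "class_weight r (class_rep r (\<sigma> ` D)) = 2" using class_weight_image[OF \<sigma> sub] by simp
    moreover have "class_rep r (\<sigma> ` D) \<in> \<B>" using D base(2) by (intro pres) (rule subsetD)
    ultimately have in_P: "class_rep r (\<sigma> ` D) \<in> ?P" by (intro weight2)
    have "card ({..r} - \<sigma> ` D) = Suc r - 2"
      using image_permutes_subset[OF \<sigma> sub] card_img
      by (simp add: card_Diff_subset finite_subset)
    then have "class_rep r (\<sigma> ` D) \<noteq> {..r} - \<sigma> ` D" using card_edge[OF in_P] r by auto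
    then have "class_rep r (\<sigma> ` D) = \<sigma> ` D" by (auto simp: class_rep_def)
    then show ?thesis using in_P by simp
  qed
  have "inj_on ((`) \<sigma>) ?P" using inj by (simp add: inj_on_def inj_image_eq_iff)
  then have surj: "(`) \<sigma> ` ?P = ?P" using maps by (intro endo_inj_surj image_subsetI) simp_all
  have end_in: "D = ?C 0" if "D \<in> ?P" "0 \<in> D" for D using that by (auto simp: edge)
  have unique: "D = \<sigma> ` ?C 0" if D: "D \<in> ?P" "\<sigma> 0 \<in> D" for D
  proof -
    obtain D' where D': "D' \<in> ?P" "D = \<sigma> ` D'" using D(1) surj by (metis imageE)
    then have "0 \<in> D'" using D(2) by (simp add: inj_image_mem_iff[OF inj])
    then show ?thesis using end_in D' by simp
  qed
  have "\<sigma> ` ?C 0 \<in> ?P" using r by (intro maps imageI) simp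
  moreover have "\<sigma> 0 \<in> \<sigma> ` ?C 0" by (simp add: edge)
  ultimately have lt: "\<sigma> 0 < r" using edge_sub by blast
  have "class_rep r (\<sigma> ` {0}) \<in> \<B>" using base(1) by (rule pres)
  then have "\<sigma> 0 \<noteq> r - 1" using lt last by (auto simp: class_rep_def)
  have "\<sigma> 0 = 0"
  proof (rule ccontr)
    assume "\<sigma> 0 \<noteq> 0"
    then obtain y where y: "\<sigma> 0 = Suc y" by (cases "\<sigma> 0") auto
    then have "Suc y < r - 1" using lt \<open>\<sigma> 0 \<noteq> r - 1\<close> by simp
    then have "?C y = \<sigma> ` ?C 0" "?C (Suc y) = \<sigma> ` ?C 0"
      using y by (intro unique imageI; simp add: edge)+
    then have "?C y = ?C (Suc y)" by simp
    then have "y \<in> {Suc y, Suc (Suc y)}" unfolding edge by blast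
    then show False by simp
  qed
  moreover have "\<sigma> ` ?C i \<in> ?P" if "i < r - 1" for i using that by (intro maps imageI) simp
  ultimately show "\<sigma> = id" using r by (intro chain_rigid[OF \<sigma>, of r]) simp_all
qed

lemma choose_2_le_power: "4 \<le> r \<Longrightarrow> (r choose 2) + 2 \<le> 2 ^ (r - 1)"
proof (induction r rule: dec_induct)
  case base
  show ?case by (simp add: choose_two)
next
  case (step r)
  have "r \<le> 2 ^ (r - 1)" using less_exp[of "r - 1"] by linarith
  moreover have "(2 :: nat) ^ r = 2 * 2 ^ (r - 1)" using step by (cases r) auto
  moreover have "Suc r choose 2 = r + (r choose 2)" by (simp add: numeral_2_eq_2)
  ultimately show ?case using step by simp
qed

text \<open>Everything between the path with its marked end and the largest collection allowed by
  \<open>path_rigid\<close> is rigid. That largest collection contains at least half of all classes, because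
  there are only quadratically many classes of weight two.\<close>

lemma rigid_size_path:
  assumes r: "4 \<le> r" and n: "r \<le> n" "n \<le> 2 ^ (r - 1)"
  shows "rigid_size r n"
proof -
  let ?P = "chain_set r r ` {..<r - 1}"
  let ?W = "{D \<in> Pow {..<r}. class_weight r D = 2}"
  let ?low = "insert {0} ?P"
  let ?ex = "insert {r - 1} (?W - ?P)"
  let ?high = "Pow {..<r} - ?ex"
  have edge: "chain_set r r i = {i, Suc i}" for i by (simp add: chain_set_def)
  have P_sub: "?P \<subseteq> ?W" using r by (auto simp: edge class_weight_def)
  have card_P: "card ?P = r - 1" using card_image[OF inj_on_chain_set] by (simp only: card_lessThan)
  have card_edge: "card D = 2" if "D \<in> ?P" for D using that by (auto simp: edge)
  have single: "{x} \<notin> ?P" for x using card_edge[of "{x}"] by auto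
  have low: "card ?low = r" using single[of 0] card_P r by simp
  \<comment> \<open>Weight two: a pair avoiding the last row, or the complement of a pair containing it.\<close>
  have "?W \<subseteq> {D. D \<subseteq> {..<r} \<and> card D = 2} \<union> {D. D \<subseteq> {..<r} \<and> card D = r - 1}"
    by (auto simp: class_weight_def min_def split: if_splits)
  then have "card ?W \<le> card ({D. D \<subseteq> {..<r} \<and> card D = 2} \<union> {D. D \<subseteq> {..<r} \<and> card D = r - 1})"
    by (intro card_mono finite_UnI) (rule finite_subset[of _ "Pow {..<r}"], auto)+
  also have "\<dots> \<le> card {D. D \<subseteq> {..<r} \<and> card D = 2} + card {D. D \<subseteq> {..<r} \<and> card D = r - 1}"
    by (rule card_Un_le)
  also have "\<dots> = (r choose 2) + r"
    using r binomial_symmetric[of 1 r] by (simp add: n_subsets)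
  finally have W: "card ?W \<le> (r choose 2) + r" .
  have fin_W: "finite ?W" by simp
  have "card (?W - ?P) = card ?W - (r - 1)"
    using P_sub card_P fin_W by (simp add: card_Diff_subset finite_subset)
  then have "card ?ex \<le> (r choose 2) + 2"
    using W r card_insert_le_m1[of "(r choose 2) + 2" "?W - ?P" "{r - 1}"] by simp
  then have ex: "card ?ex \<le> 2 ^ (r - 1)" using choose_2_le_power[OF r] by simp
  have "card (Pow {..<r}) - card ?ex \<le> card ?high" by (rule diff_card_le_card_Diff) (use fin_W in simp)
  moreover have "(2 :: nat) ^ r = 2 ^ (r - 1) + 2 ^ (r - 1)" using r by (cases r) auto
  moreover have "card (Pow {..<r}) = 2 ^ r" by (simp add: card_Pow)
  ultimately have high: "2 ^ (r - 1) \<le> card ?high" using ex by linarith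
  have "{0} \<notin> ?ex" using r by (auto simp: class_weight_def)
  moreover have "{r - 1} \<notin> ?P" by (rule single)
  moreover have "{0} \<in> Pow {..<r}" using r by simp
  moreover have "?P \<subseteq> Pow {..<r}" using P_sub by (rule subset_trans) (rule Collect_restrict)
  ultimately have "?low \<subseteq> ?high" by (intro insert_subsetI DiffI subsetI) (auto dest: subsetD)
  moreover have "card ?low \<le> n" "n \<le> card ?high" using low high n by linarith+
  ultimately obtain \<B> where \<B>: "?low \<subseteq> \<B>" "\<B> \<subseteq> ?high" "card \<B> = n"
    using exists_subset_between[of ?low n ?high] by auto
  have "\<B> \<subseteq> Pow {..<r}" using \<B>(2) by (rule subset_trans) (rule Diff_subset)
  have not_ex: "D \<notin> ?ex" if "D \<in> \<B>" for D using subsetD[OF \<B>(2) that] by (elim DiffE)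
  have "rigid r \<B>"
  proof (rule path_rigid[OF r \<open>\<B> \<subseteq> Pow {..<r}\<close>])
    show "{0} \<in> \<B>" "?P \<subseteq> \<B>" using \<B>(1) by simp_all
    show "{r - 1} \<notin> \<B>" using not_ex by blast
    show "D \<in> ?P" if "D \<in> \<B>" "class_weight r D = 2" for D
      using not_ex[OF that(1)] subsetD[OF \<open>\<B> \<subseteq> Pow {..<r}\<close> that(1)] that(2) by blast
  qed
  then show ?thesis using \<B>(3) \<open>\<B> \<subseteq> Pow {..<r}\<close> unfolding rigid_size_def by metis
qed

lemma rigid_size_upto:
  assumes "rigid_size r k" "1 \<le> r" "k \<le> n" "n \<le> Suc (Suc r div 2)"
  shows "rigid_size r n"
  using assms(3,4,1)
proof (induction n rule: dec_induct)
  case (step n)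
  then show ?case using rigid_size_Suc[of r n] assms(2) by simp
qed

section \<open>At most four rows\<close>

lemma rigid_moves_set:
  assumes "rigid r \<B>" "\<sigma> permutes {..r}" "\<sigma> \<noteq> id"
  shows "\<exists>D\<in>\<B>. class_rep r (\<sigma> ` D) \<notin> \<B>"
  using assms unfolding rigid_def by blast

lemma transpose_neq_id:
  assumes "a \<le> r" "b \<le> r" "a \<noteq> b"
  shows "Transposition.transpose a b permutes {..r :: nat}" "Transposition.transpose a b \<noteq> id"
proof -
  show "Transposition.transpose a b permutes {..r}"
    using assms by (intro permutes_swap_id) simp_all
  show "Transposition.transpose a b \<noteq> id" using assms(3) by (metis id_apply transpose_apply_first)
qed

text \<open>Membership of the three singleton classes takes two values only, so two of them agree, and the
  transposition of the corresponding rows is a symmetry. The class of \<open>{2}\<close> is represented by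
  \<open>{0, 1}\<close>.\<close>

lemma not_rigid_size_2: "\<not> rigid_size 2 n"
proof
  assume "rigid_size 2 n"
  then obtain \<B> where \<B>: "\<B> \<subseteq> Pow {..<2}" and rigid: "rigid 2 \<B>"
    by (auto simp: rigid_size_def)
  have pow: "Pow {..<2 :: nat} = {{}, {0}, {1}, {0, 1}}"
    by (simp add: numeral_eq_Suc lessThan_Suc Pow_insert insert_commute)
  have univ: "{..2 :: nat} = {0, 1, 2}" by auto
  have moved: "({} \<in> \<B> \<and> class_rep 2 (\<sigma> ` {}) \<notin> \<B>) \<or>
      ({0} \<in> \<B> \<and> class_rep 2 (\<sigma> ` {0}) \<notin> \<B>) \<or>
      ({1} \<in> \<B> \<and> class_rep 2 (\<sigma> ` {1}) \<notin> \<B>) \<or>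
      ({0, 1} \<in> \<B> \<and> class_rep 2 (\<sigma> ` {0, 1}) \<notin> \<B>)"
    if \<sigma>: "\<sigma> permutes {..2}" "\<sigma> \<noteq> id" for \<sigma>
  proof -
    obtain D where D: "D \<in> \<B>" "class_rep 2 (\<sigma> ` D) \<notin> \<B>"
      using rigid_moves_set[OF rigid \<sigma>] by blast
    have "D \<in> {{}, {0}, {1}, {0, 1}}" using subsetD[OF \<B> D(1)] unfolding pow .
    then show ?thesis using D by (elim insertE emptyE) simp_all
  qed
  note compute = class_rep_def Transposition.transpose_def univ insert_commute insert_Diff_if
  have "{0} \<in> \<B> \<longleftrightarrow> {1} \<notin> \<B>"
    using moved[OF transpose_neq_id[of 0 2 1]] by (simp add: compute) blast
  moreover have "{0} \<in> \<B> \<longleftrightarrow> {0, 1} \<notin> \<B>"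
    using moved[OF transpose_neq_id[of 0 2 2]] by (simp add: compute) blast
  moreover have "{1} \<in> \<B> \<longleftrightarrow> {0, 1} \<notin> \<B>"
    using moved[OF transpose_neq_id[of 1 2 2]] by (simp add: compute) blast
  ultimately show False by blast
qed

text \<open>Besides the empty class there are four singleton classes, where \<open>{3}\<close> is represented by
  \<open>{0, 1, 2}\<close>, and three splittings into pairs. If exactly two of the singletons belong to the
  collection, or none or all do, then a double transposition preserves the singletons; it
  fixes every splitting. Otherwise three singletons agree, the transpositions of their rows induce all
  transpositions of the three splittings, and two splittings agree. The proof records what each of these
  nine involutions would need; the resulting propositional conditions are contradictory.\<close>

lemma not_rigid_size_3: "\<not> rigid_size 3 n"
proof
  assume "rigid_size 3 n"
  then obtain \<B> where \<B>: "\<B> \<subseteq> Pow {..<3}" and rigid: "rigid 3 \<B>"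
    by (auto simp: rigid_size_def)
  have pow: "Pow {..<3 :: nat} = {{}, {0}, {1}, {2}, {0, 1}, {0, 2}, {1, 2}, {0, 1, 2}}"
    by (simp add: numeral_eq_Suc lessThan_Suc Pow_insert insert_commute)
  have univ: "{..3 :: nat} = {0, 1, 2, 3}" by auto
  have moved: "({} \<in> \<B> \<and> class_rep 3 (\<sigma> ` {}) \<notin> \<B>) \<or>
      ({0} \<in> \<B> \<and> class_rep 3 (\<sigma> ` {0}) \<notin> \<B>) \<or>
      ({1} \<in> \<B> \<and> class_rep 3 (\<sigma> ` {1}) \<notin> \<B>) \<or>
      ({2} \<in> \<B> \<and> class_rep 3 (\<sigma> ` {2}) \<notin> \<B>) \<or>
      ({0, 1} \<in> \<B> \<and> class_rep 3 (\<sigma> ` {0, 1}) \<notin> \<B>) \<or>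
      ({0, 2} \<in> \<B> \<and> class_rep 3 (\<sigma> ` {0, 2}) \<notin> \<B>) \<or>
      ({1, 2} \<in> \<B> \<and> class_rep 3 (\<sigma> ` {1, 2}) \<notin> \<B>) \<or>
      ({0, 1, 2} \<in> \<B> \<and> class_rep 3 (\<sigma> ` {0, 1, 2}) \<notin> \<B>)"
    if \<sigma>: "\<sigma> permutes {..3}" "\<sigma> \<noteq> id" for \<sigma>
  proof -
    obtain D where D: "D \<in> \<B>" "class_rep 3 (\<sigma> ` D) \<notin> \<B>"
      using rigid_moves_set[OF rigid \<sigma>] by blast
    have "D \<in> {{}, {0}, {1}, {2}, {0, 1}, {0, 2}, {1, 2}, {0, 1, 2}}"
      using subsetD[OF \<B> D(1)] unfolding pow .
    then show ?thesis using D by (elim insertE emptyE) simp_all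
  qed
  have double: "\<sigma> permutes {..3}" "\<sigma> \<noteq> id"
    if "\<sigma> = Transposition.transpose 0 a \<circ> Transposition.transpose b c"
      "a \<le> 3" "b \<le> 3" "c \<le> 3" "a \<noteq> 0" "b \<noteq> 0" "c \<noteq> 0" for \<sigma> and a b c :: nat
  proof -
    show "\<sigma> permutes {..3}"
      unfolding that(1) by (intro permutes_compose permutes_swap_id) (use that in auto)
    have "\<sigma> 0 = a" using that by (simp add: Transposition.transpose_def)
    then show "\<sigma> \<noteq> id" using that(5) by auto
  qed
  note compute = class_rep_def Transposition.transpose_def univ insert_commute insert_Diff_if
  have "\<not> (({0} \<in> \<B> \<longleftrightarrow> {1} \<in> \<B>) \<and> ({0, 2} \<in> \<B> \<longleftrightarrow> {1, 2} \<in> \<B>))"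
    using moved[OF transpose_neq_id[of 0 3 1]] by (simp add: compute) blast
  moreover have "\<not> (({0} \<in> \<B> \<longleftrightarrow> {2} \<in> \<B>) \<and> ({0, 1} \<in> \<B> \<longleftrightarrow> {1, 2} \<in> \<B>))"
    using moved[OF transpose_neq_id[of 0 3 2]] by (simp add: compute) blast
  moreover have "\<not> (({0} \<in> \<B> \<longleftrightarrow> {0, 1, 2} \<in> \<B>) \<and> ({0, 1} \<in> \<B> \<longleftrightarrow> {0, 2} \<in> \<B>))"
    using moved[OF transpose_neq_id[of 0 3 3]] by (simp add: compute) blast
  moreover have "\<not> (({1} \<in> \<B> \<longleftrightarrow> {2} \<in> \<B>) \<and> ({0, 1} \<in> \<B> \<longleftrightarrow> {0, 2} \<in> \<B>))"
    using moved[OF transpose_neq_id[of 1 3 2]] by (simp add: compute) blast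
  moreover have "\<not> (({1} \<in> \<B> \<longleftrightarrow> {0, 1, 2} \<in> \<B>) \<and> ({0, 1} \<in> \<B> \<longleftrightarrow> {1, 2} \<in> \<B>))"
    using moved[OF transpose_neq_id[of 1 3 3]] by (simp add: compute) blast
  moreover have "\<not> (({2} \<in> \<B> \<longleftrightarrow> {0, 1, 2} \<in> \<B>) \<and> ({0, 2} \<in> \<B> \<longleftrightarrow> {1, 2} \<in> \<B>))"
    using moved[OF transpose_neq_id[of 2 3 3]] by (simp add: compute) blast
  moreover have "\<not> (({0} \<in> \<B> \<longleftrightarrow> {1} \<in> \<B>) \<and> ({2} \<in> \<B> \<longleftrightarrow> {0, 1, 2} \<in> \<B>))"
    using moved[OF double[OF refl, of 1 2 3]] by (simp add: compute) blast
  moreover have "\<not> (({0} \<in> \<B> \<longleftrightarrow> {2} \<in> \<B>) \<and> ({1} \<in> \<B> \<longleftrightarrow> {0, 1, 2} \<in> \<B>))"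
    using moved[OF double[OF refl, of 2 1 3]] by (simp add: compute) blast
  moreover have "\<not> (({0} \<in> \<B> \<longleftrightarrow> {0, 1, 2} \<in> \<B>) \<and> ({1} \<in> \<B> \<longleftrightarrow> {2} \<in> \<B>))"
    using moved[OF double[OF refl, of 3 1 2]] by (simp add: compute) blast
  ultimately show False by argo
qed

section \<open>The cost of distinguishing hypercubes\<close>

lemma nu_eq: "nu m = (LEAST n. asymmetric_size m n)"
  by (simp add: nu_def asymmetric_size_def)

lemma nu_le: "asymmetric_size m n \<Longrightarrow> nu m \<le> n"
  unfolding nu_eq by (rule Least_le)

lemma asymmetric_size_nu:
  assumes "5 \<le> m"
  shows "asymmetric_size m (nu m)" "nu m < m"
proof -
  obtain r where r: "m = Suc r" "4 \<le> r" using assms by (cases m) auto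
  have "r \<le> 2 ^ (r - 1)" using less_exp[of "r - 1"] by linarith
  then have size: "asymmetric_size m r"
    using r by (simp add: asymmetric_size_Suc_iff rigid_size_path)
  then show "nu m < m" using nu_le[OF size] r by simp
  show "asymmetric_size m (nu m)" unfolding nu_eq using size by (rule LeastI)
qed

text \<open>The ranges of \<open>rigid_size_upto\<close> and \<open>rigid_size_path\<close> leave a gap only for \<open>r \<ge> 6\<close>; the
  numbers in it are large enough for \<open>rigid_size_thick_path\<close>.\<close>

lemma asymmetric_size_lower_half:
  assumes r: "4 \<le> r" and n: "nu (Suc r) \<le> n" "n \<le> 2 ^ (r - 1)"
  shows "asymmetric_size (Suc r) n"
proof -
  have base: "rigid_size r (nu (Suc r))"
    using asymmetric_size_nu(1)[of "Suc r"] r by (simp add: asymmetric_size_Suc_iff)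
  consider "r \<le> n" | "n \<le> Suc (Suc r div 2)" | "n < r" "Suc (Suc r div 2) < n" by linarith
  then have "rigid_size r n"
  proof cases
    case 1
    then show ?thesis using rigid_size_path r n by simp
  next
    case 2
    then show ?thesis using rigid_size_upto[OF base] r n by simp
  next
    case 3
    then have "6 \<le> r" "r \<le> 2 * n - 2" by linarith+
    then show ?thesis using rigid_size_thick_path 3 by simp
  qed
  then show ?thesis by (simp add: asymmetric_size_Suc_iff)
qed

text \<open>The complement of a collection of \<open>n\<close> classes has \<open>2\<^bsup>m-1\<^esup> - n\<close> classes, which gives the upper bound
  and reduces the construction to the lower half.\<close>

lemma asymmetric_size_iff:
  assumes m: "5 \<le> m"
  shows "asymmetric_size m n \<longleftrightarrow> nu m \<le> n \<and> n + nu m \<le> 2 ^ (m - 1)"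
proof
  assume size: "asymmetric_size m n"
  obtain r where r: "m = Suc r" using m by (cases m) auto
  have "n \<le> 2 ^ r" "asymmetric_size m (2 ^ r - n)"
    using size rigid_size_le rigid_size_complement by (auto simp: r asymmetric_size_Suc_iff)
  then have "nu m \<le> 2 ^ r - n" using nu_le by blast
  then show "nu m \<le> n \<and> n + nu m \<le> 2 ^ (m - 1)"
    using nu_le[OF size] \<open>n \<le> 2 ^ r\<close> by (simp add: r)
next
  assume n: "nu m \<le> n \<and> n + nu m \<le> 2 ^ (m - 1)"
  obtain r where r: "m = Suc r" "4 \<le> r" using m by (cases m) auto
  have half: "(2 :: nat) ^ r = 2 ^ (r - 1) + 2 ^ (r - 1)" using r(2) by (cases r) auto
  show "asymmetric_size m n"
  proof (cases "n \<le> 2 ^ (r - 1)")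
    case True
    then show ?thesis using asymmetric_size_lower_half r n by simp
  next
    case False
    have "2 ^ r - n \<le> 2 ^ (r - 1)" "nu (Suc r) \<le> 2 ^ r - n" "2 ^ r - (2 ^ r - n) = n"
      using False half n r by auto
    then show ?thesis
      using asymmetric_size_lower_half[OF r(2)] rigid_size_complement
      unfolding r(1) asymmetric_size_Suc_iff by metis
  qed
qed

lemma not_asymmetric_size_small:
  assumes "m \<le> 4" "4 \<le> n"
  shows "\<not> asymmetric_size m n"
proof
  assume size: "asymmetric_size m n"
  have "m \<noteq> 0" using size not_asymmetric_size_0[of n] assms(2) by (intro notI) simp
  then obtain r where r: "m = Suc r" by (cases m) auto
  then have rigid: "rigid_size r n" using size by (simp add: asymmetric_size_Suc_iff)
  consider "r = 0" | "r = 1" | "r = 2" | "r = 3" using assms(1) r by linarith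
  then show False
  proof cases
    case 3
    then show False using rigid not_rigid_size_2 by simp
  next
    case 4
    then show False using rigid not_rigid_size_3 by simp
  qed (use rigid_size_le[OF rigid] assms(2) in simp_all)
qed

text \<open>If fewer than four columns sufficed, then so would exactly three, and the three remaining vertices of \<open>Q\<^sub>3\<close> would form an asymmetric
  matrix with three rows, which \<open>not_rigid_size_2\<close> excludes.\<close>

lemma nu_5: "nu 5 = 4"
proof -
  have "4 \<le> nu 5"
  proof (rule ccontr)
    assume "\<not> 4 \<le> nu 5"
    then have "nu 5 \<le> 3" by simp
    then have "asymmetric_size 5 3" by (simp add: asymmetric_size_iff)
    then have "asymmetric_size (2 ^ 3 - 5) 3" by (rule asymmetric_size_complement_rows)
    then have "asymmetric_size (Suc 2) 3" by simp
    then show False using not_rigid_size_2 unfolding asymmetric_size_Suc_iff by blast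
  qed
  then show ?thesis using asymmetric_size_nu(2)[of 5] by simp
qed

lemma Suc_le_power_int: "int (Suc r) \<le> 2 ^ r"
  by (induction r) auto

lemma upper_bound_step:
  assumes "5 \<le> m"
  shows "(2 :: int) ^ (m - 1) - int (nu m) \<le> 2 ^ m - int (nu (Suc m))"
proof -
  obtain r where r: "m = Suc r" using assms by (cases m) auto
  have "int (Suc r) \<le> 2 ^ r" by (rule Suc_le_power_int)
  moreover have "nu (Suc m) \<le> Suc r" using asymmetric_size_nu(2)[of "Suc m"] assms r by simp
  moreover have "(2 :: int) ^ m = 2 * 2 ^ r" "m - 1 = r" by (simp_all add: r)
  ultimately show ?thesis by (simp only:)
qed

lemma upper_bound_mono:
  assumes "5 \<le> k" "k \<le> m"
  shows "(2 :: int) ^ (k - 1) - int (nu k) \<le> 2 ^ (m - 1) - int (nu m)"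
  using assms(2)
proof (induction m rule: dec_induct)
  case (step m)
  then show ?case using upper_bound_step[of m] assms(1) by simp
qed simp

lemma asymmetric_size_imp_le:
  assumes "5 \<le> m" "asymmetric_size m n"
  shows "int n \<le> 2 ^ (m - 1) - int (nu m)"
proof -
  have "int (n + nu m) \<le> int (2 ^ (m - 1))"
    using assms asymmetric_size_iff by (simp only: of_nat_le_iff)
  then show ?thesis by simp
qed

lemma cost2_hypercube_5:
  assumes n: "4 \<le> n" "n \<le> 12"
  shows "cost2 (hypercube n) = 5"
  unfolding cost2_hypercube
proof (rule Least_equality)
  show "asymmetric_size 5 n" using n by (simp add: asymmetric_size_iff nu_5)
  show "5 \<le> m" if "asymmetric_size m n" for m
    using not_asymmetric_size_small[of m n] n that by linarith
qed

text \<open>For fewer rows \<open>n\<close> exceeds the largest possible number of columns. For \<open>m\<close> rows it is not too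
  small either: with \<open>m = q + 3\<close>, the number \<open>n\<close> is at least
  \<open>2 * 2 ^ q - q \<ge> q + 2 \<ge> nu m\<close>.\<close>

lemma cost2_hypercube_between:
  assumes n: "13 \<le> n" and m: "6 \<le> m"
    and lower: "2 ^ (m - 2) - int (nu (m - 1)) + 1 \<le> int n"
    and upper: "int n \<le> 2 ^ (m - 1) - int (nu m)"
  shows "cost2 (hypercube n) = m"
  unfolding cost2_hypercube
proof (rule Least_equality)
  define q where "q = m - 3"
  have q: "m = q + 3" using m by (simp add: q_def)
  have "int (Suc q) \<le> 2 ^ q" by (rule Suc_le_power_int)
  moreover have "nu m \<le> q + 2" "nu (m - 1) \<le> q + 1"
    using asymmetric_size_nu(2)[of m] asymmetric_size_nu(2)[of "m - 1"] m q by simp_all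
  moreover have "(2 :: int) ^ (m - 2) = 2 * 2 ^ q" by (simp add: q)
  ultimately have "int (nu m) \<le> int n" using lower by linarith
  moreover have "int (n + nu m) \<le> int (2 ^ (m - 1))" using upper by simp
  ultimately show "asymmetric_size m n" using m by (simp only: asymmetric_size_iff of_nat_le_iff)
  show "m \<le> k" if size: "asymmetric_size k n" for k
  proof (rule ccontr)
    assume "\<not> m \<le> k"
    then have "k \<le> m - 1" by simp
    have k: "5 \<le> k" using not_asymmetric_size_small[of k n] size n by linarith
    have "int n \<le> 2 ^ (k - 1) - int (nu k)" using k size by (rule asymmetric_size_imp_le)
    also have "\<dots> \<le> 2 ^ (m - 1 - 1) - int (nu (m - 1))"
      using k \<open>k \<le> m - 1\<close> by (rule upper_bound_mono)
    also have "m - 1 - 1 = m - 2" by simp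
    finally show False using lower by linarith
  qed
qed

text \<open>Take the least \<open>m\<close> whose upper bound reaches \<open>n\<close>; it is not 5, as the bound there is
  \<open>16 - 4 = 12\<close>. Uniqueness holds because every such \<open>m\<close> equals the cost of the hypercube.\<close>

lemma ex1_cost_interval:
  assumes n: "13 \<le> n"
  shows "\<exists>!m. 6 \<le> m \<and> 2 ^ (m - 2) - int (nu (m - 1)) + 1 \<le> int n \<and>
    int n \<le> 2 ^ (m - 1) - int (nu m)"
proof -
  define P where "P m \<longleftrightarrow> 5 \<le> m \<and> int n \<le> 2 ^ (m - 1) - int (nu m)" for m
  \<comment> \<open>Any sufficiently large index would do.\<close>
  have "P (n + 6)"
  proof -
    have "nu (n + 6) \<le> n + 5" using asymmetric_size_nu(2)[of "n + 6"] by simp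
    moreover have "int (Suc n) \<le> 2 ^ n" by (rule Suc_le_power_int)
    moreover have "(2 :: int) ^ (n + 6 - 1) = 32 * 2 ^ n" by (simp add: power_add)
    ultimately show ?thesis unfolding P_def using n by linarith
  qed
  define m where "m = (LEAST m. P m)"
  have "P m" unfolding m_def using \<open>P (n + 6)\<close> by (rule LeastI)
  have "m \<noteq> 5" using \<open>P m\<close> n by (auto simp: P_def nu_5)
  then have m6: "6 \<le> m" using \<open>P m\<close> by (simp add: P_def)
  have "\<not> P (m - 1)" unfolding m_def by (rule not_less_Least) (use m6 in \<open>simp add: m_def\<close>)
  moreover have pred: "m - 1 - 1 = m - 2" by simp
  moreover have "5 \<le> m - 1" using m6 by simp
  ultimately have "\<not> int n \<le> 2 ^ (m - 2) - int (nu (m - 1))" unfolding P_def pred by blast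
  then have "2 ^ (m - 2) - int (nu (m - 1)) + 1 \<le> int n" by linarith
  show ?thesis
  proof (rule ex1I)
    show "6 \<le> m \<and> 2 ^ (m - 2) - int (nu (m - 1)) + 1 \<le> int n \<and>
        int n \<le> 2 ^ (m - 1) - int (nu m)"
      using \<open>P m\<close> m6 \<open>2 ^ (m - 2) - int (nu (m - 1)) + 1 \<le> int n\<close> by (simp add: P_def)
    show "k = m" if "6 \<le> k \<and> 2 ^ (k - 2) - int (nu (k - 1)) + 1 \<le> int n \<and>
        int n \<le> 2 ^ (k - 1) - int (nu k)" for k
      using cost2_hypercube_between[OF n, of k] cost2_hypercube_between[OF n, of m] that
        \<open>P m\<close> m6 \<open>2 ^ (m - 2) - int (nu (m - 1)) + 1 \<le> int n\<close> by (simp add: P_def)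
  qed
qed

theorem theorem11:
  shows "(\<forall>n::nat. 4 \<le> n \<and> n \<le> 12 \<longrightarrow> cost2 (hypercube n) = 5) \<and>
    (\<forall>n::nat. n \<ge> 13 \<longrightarrow>
       (\<exists>!m::nat. m \<ge> 6 \<and> 2 ^ (m - 2) - int (nu (m - 1)) + 1 \<le> int n
                     \<and> int n \<le> 2 ^ (m - 1) - int (nu m)) \<and>
       (\<forall>m::nat. m \<ge> 6 \<and> 2 ^ (m - 2) - int (nu (m - 1)) + 1 \<le> int n
                     \<and> int n \<le> 2 ^ (m - 1) - int (nu m) \<longrightarrow>
                   cost2 (hypercube n) = m))"
  using cost2_hypercube_5 ex1_cost_interval cost2_hypercube_between by simp

end
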